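(* Let $\alpha\in(0,1)$, $A>0$ and $a\ge 0$ be constants, and set $\epsilon(n) = A/\sqrt{n}$ and $k(n) = \alpha n$ (for $n$ with $k(n)$ an integer). Consider the skewed spectral algorithm with parameter $a$: on input a graph $G$ on $n$ vertices, compute the largest eigenvalue $\lambda_1(\widehat{A})$ of its skewed adjacency matrix $\widehat{A} = \frac12 S + \frac{a}{\sqrt n}J$, and certify that $G$ does not contain any $k$-subgraph with excess $\epsilon$ for all $k,\epsilon$ with $\epsilon(k-1) + ka/\sqrt{n} > \lambda_1(\widehat{A})$. If $\alpha A + \alpha a > \sqrt{a^2 + 5/4}$, then this algorithm certifies (correctly) that most graphs on $n$ vertices do not have any $k(n)$-subgraph with excess $\epsilon(n)$.
   Context: The signed adjacency matrix $S$ of a graph $G$ on $\{1,\dots,n\}$ has $S_{ii}=0$, $S_{ij}=1$ if $ij$ is an edge and $S_{ij}=-1$ otherwise; $J$ is the $n\times n$ all-ones matrix. A graph on $k$ vertices has density $\lambda$ if it has at least $\lambda k(k-1)/2$ edges, and excess $\epsilon\ge0$ if it has density $1/2+\epsilon$. A $k$-subgraph is an induced subgraph on $k$ vertices. "Certifying that most graphs on $n$ vertices do not have any $k(n)$-subgraph with excess $\epsilon(n)$" means: every certified graph has no such subgraph, and the fraction of graphs on $\{1,\dots,n\}$ that are certified tends to $1$ as $n\to\infty$. *)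

theory Defs
  imports
    "HOL-Analysis.Analysis"
    "Jordan_Normal_Form.Spectral_Radius"
begin

text \<open>A simple graph on the vertex set \<open>{1..n}\<close> is identified with its set of edges, each edge
  being a two-element set of vertices.\<close>

definition graphs_on :: "nat \<Rightarrow> nat set set set" where
  "graphs_on n = Pow {e. e \<subseteq> {1..n} \<and> card e = 2}"

definition induced_edges :: "nat set set \<Rightarrow> nat set \<Rightarrow> nat set set" where
  "induced_edges E W = {e \<in> E. e \<subseteq> W}"

definition has_density :: "nat set \<Rightarrow> nat set set \<Rightarrow> real \<Rightarrow> bool" where
  "has_density W F d \<longleftrightarrow>
     real (card F) \<ge> d * (real (card W) * (real (card W) - 1) / 2)"

definition has_excess :: "nat set \<Rightarrow> nat set set \<Rightarrow> real \<Rightarrow> bool" where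
  "has_excess W F \<epsilon> \<longleftrightarrow> 0 \<le> \<epsilon> \<and> has_density W F (1/2 + \<epsilon>)"

definition has_subgraph_with_excess ::
  "nat \<Rightarrow> nat set set \<Rightarrow> nat \<Rightarrow> real \<Rightarrow> bool" where
  "has_subgraph_with_excess n E k \<epsilon> \<longleftrightarrow>
     (\<exists>W. W \<subseteq> {1..n} \<and> card W = k \<and> has_excess W (induced_edges E W) \<epsilon>)"

text \<open>Matrix indices start at 0, so row \<open>i\<close> belongs to vertex \<open>Suc i\<close>.\<close>

definition signed_adjacency :: "nat \<Rightarrow> nat set set \<Rightarrow> real mat" where
  "signed_adjacency n E = mat n n (\<lambda>(i, j).
     if i = j then 0 else if {Suc i, Suc j} \<in> E then 1 else - 1)"

definition all_ones :: "nat \<Rightarrow> real mat" where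
  "all_ones n = mat n n (\<lambda>_. 1)"

definition skewed_adjacency :: "real \<Rightarrow> nat \<Rightarrow> nat set set \<Rightarrow> real mat" where
  "skewed_adjacency a n E =
     (1/2) \<cdot>\<^sub>m signed_adjacency n E + (a / sqrt (real n)) \<cdot>\<^sub>m all_ones n"

text \<open>Only meaningful when the real spectrum is nonempty, as it is for a real symmetric matrix of
  positive dimension.\<close>

definition largest_eigenvalue :: "real mat \<Rightarrow> real" where
  "largest_eigenvalue M = Max (spectrum M)"

text \<open>A certification algorithm maps the number of vertices and a graph to the set of all pairs
  \<open>(k, \<epsilon>)\<close> for which it certifies that the graph has no \<open>k\<close>-subgraph with excess \<open>\<epsilon>\<close>.\<close>

type_synonym certifier = "nat \<Rightarrow> nat set set \<Rightarrow> (nat \<times> real) set"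

definition skewed_spectral :: "real \<Rightarrow> certifier" where
  "skewed_spectral a n E = {(k, \<epsilon>).
     \<epsilon> * (real k - 1) + real k * a / sqrt (real n) > largest_eigenvalue (skewed_adjacency a n E)}"

definition certified_graphs :: "certifier \<Rightarrow> nat \<Rightarrow> nat \<Rightarrow> real \<Rightarrow> nat set set set" where
  "certified_graphs alg n k \<epsilon> = {E \<in> graphs_on n. (k, \<epsilon>) \<in> alg n E}"

text \<open>The set \<open>N\<close> contains the admissible numbers of vertices; the limit is taken as \<open>n\<close> tends to
  infinity within \<open>N\<close>.\<close>

definition certifies_most ::
  "certifier \<Rightarrow> nat set \<Rightarrow> (nat \<Rightarrow> nat) \<Rightarrow> (nat \<Rightarrow> real) \<Rightarrow> bool" where
  "certifies_most alg N k \<epsilon> \<longleftrightarrow>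
     (\<forall>n\<in>N. \<forall>E\<in>certified_graphs alg n (k n) (\<epsilon> n). \<not> has_subgraph_with_excess n E (k n) (\<epsilon> n)) \<and>
     ((\<lambda>n. real (card (certified_graphs alg n (k n) (\<epsilon> n))) / real (card (graphs_on n)))
        \<longlongrightarrow> 1) (inf sequentially (principal N))"

end

theory Submission
  imports Defs "HOL-Real_Asymp.Real_Asymp"
begin

text \<open>
  Soundness is the Rayleigh principle applied to the indicator vector of a dense subgraph.

  For the limit, decompose the top eigenvector as \<open>x = c 1 + y\<close> with \<open>y\<close> orthogonal to the all-ones
  vector \<open>1\<close>. The skewed matrix acts on \<open>y\<close> as \<open>S/2\<close>, so
  \<open>\<lambda>\<^sub>1\<^sup>2 \<le> \<parallel>a \<surd>n 1 + S1/2\<parallel>\<^sup>2 / n + \<parallel>S/2\<parallel>\<^sup>2\<close>. Two second moments show that the first term is typically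
  \<open>(a\<^sup>2 + 1/4 + o(1)) n\<close>, and \<open>\<parallel>S\<parallel> \<le> (2 + o(1)) \<surd>n\<close> makes the second one \<open>(1 + o(1)) n\<close>.

  The norm of \<open>S\<close> is bounded by \<open>E (Tr S\<^sup>2\<^sup>p)\<close> with \<open>p\<close> about \<open>n\<^sup>1\<^sup>/\<^sup>4\<close>. Instead of counting closed walks,
  use that Gaussian integration by parts holds for random signs as an inequality when tested against
  polynomials with nonnegative coefficients. It bounds \<open>E (Tr S\<^sup>k\<^sup>1 \<dots> Tr S\<^sup>k\<^sup>m)\<close> recursively, and
  a perturbed Catalan recursion solves the resulting inequalities.
\<close>

section \<open>Positive polynomials in independent random signs\<close>

text \<open>A power \<open>x^m\<close> of a sign reduces to 1 or \<open>x\<close>, so its discrete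
  derivative is 1 or 0, whereas the formal derivative \<open>m x^(m-1)\<close> reduces to
  \<open>m\<close> or \<open>m x\<close>. The excess is a polynomial with nonnegative coefficients:
  it may be negative pointwise, but its mean is not. Hence every comparison is made modulo a cone of
  such polynomials and never pointwise. For a single trace the recursion already produces means of
  products of two traces, which do not factor. The induction therefore ranges over all lists of
  exponents, while the bound that it proves does factor over the list. The 2 in the norm bound is
  the point where \<open>x = 1 + q x^2\<close> stops having real solutions: with traces scaled by
  powers of \<open>r sqrt n\<close>, \<open>q = 1/r^2\<close> has to be at most 1/4. A trace may
  exceed the largest eigenvalue power by a factor \<open>n\<close>, so \<open>p\<close> must outgrow
  \<open>log n\<close> for this factor to be harmless; the lower-order terms of the recursion are
  what keeps \<open>p\<close> small. Integration by parts yields upper bounds only, so the one lower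
  bound required, on the mean squared row sums, has a separate argument.\<close>

definition rad :: "'a \<Rightarrow> 'a set \<Rightarrow> real" where
  "rad e E = (if e \<in> E then 1 else - 1)"

definition expect :: "'a set \<Rightarrow> ('a set \<Rightarrow> real) \<Rightarrow> real" where
  "expect U f = (\<Sum>E\<in>Pow U. f E) / real (card (Pow U))"

text \<open>Membership certifies a nonnegative mean, not nonnegative values: a single sign is a
  member.\<close>

inductive_set pos_cone :: "'a set \<Rightarrow> ('a set \<Rightarrow> real) set" for U where
  const: "0 \<le> c \<Longrightarrow> (\<lambda>_. c) \<in> pos_cone U"
| rad: "e \<in> U \<Longrightarrow> rad e \<in> pos_cone U"
| add: "f \<in> pos_cone U \<Longrightarrow> g \<in> pos_cone U \<Longrightarrow> (\<lambda>E. f E + g E) \<in> pos_cone U"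
| mult: "f \<in> pos_cone U \<Longrightarrow> g \<in> pos_cone U \<Longrightarrow> (\<lambda>E. f E * g E) \<in> pos_cone U"

definition flip :: "'a \<Rightarrow> 'a set \<Rightarrow> 'a set" where
  "flip e E = (if e \<in> E then E - {e} else insert e E)"

text \<open>If \<open>f = g + x h\<close> with \<open>x\<close> the sign of \<open>e\<close> and
  \<open>g\<close>, \<open>h\<close> independent of it, then the even part is \<open>g\<close> and
  the odd part is \<open>x h\<close>. Thus \<open>rad e E * odd_part e f E\<close> is the discrete
  derivative \<open>h\<close>.\<close>

definition even_part :: "'a \<Rightarrow> ('a set \<Rightarrow> real) \<Rightarrow> 'a set \<Rightarrow> real" where
  "even_part e f E = (f E + f (flip e E)) / 2"

definition odd_part :: "'a \<Rightarrow> ('a set \<Rightarrow> real) \<Rightarrow> 'a set \<Rightarrow> real" where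
  "odd_part e f E = (f E - f (flip e E)) / 2"

lemma rad_mult_self: "rad e E * rad e E = 1"
  by (simp add: rad_def)

lemma flip_flip: "flip e (flip e E) = E"
  by (auto simp: flip_def)

lemma rad_flip: "rad e (flip e E) = - rad e E" "e' \<noteq> e \<Longrightarrow> rad e' (flip e E) = rad e' E"
  by (auto simp: rad_def flip_def)

lemma parts_sum: "f E = even_part e f E + odd_part e f E"
  by (simp add: even_part_def odd_part_def field_simps)

lemma parts_rad:
  "even_part e (rad e) = (\<lambda>_. 0)" "odd_part e (rad e) = rad e"
  "e' \<noteq> e \<Longrightarrow> even_part e (rad e') = rad e'" "e' \<noteq> e \<Longrightarrow> odd_part e (rad e') = (\<lambda>_. 0)"
  by (auto simp: even_part_def odd_part_def rad_flip)

lemma parts_const: "even_part e (\<lambda>_. c) = (\<lambda>_. c)" "odd_part e (\<lambda>_. c) = (\<lambda>_. 0)"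
  by (auto simp: even_part_def odd_part_def)

lemma parts_add:
  "even_part e (\<lambda>E. f E + g E) = (\<lambda>E. even_part e f E + even_part e g E)"
  "odd_part e (\<lambda>E. f E + g E) = (\<lambda>E. odd_part e f E + odd_part e g E)"
  by (auto simp: even_part_def odd_part_def field_simps)

lemma parts_mult:
  "even_part e (\<lambda>E. f E * g E) =
    (\<lambda>E. even_part e f E * even_part e g E + odd_part e f E * odd_part e g E)"
  "odd_part e (\<lambda>E. f E * g E) =
    (\<lambda>E. even_part e f E * odd_part e g E + odd_part e f E * even_part e g E)"
  by (auto simp: even_part_def odd_part_def field_simps)

text \<open>Even and odd parts multiply like a grading by parity, with plus signs only, so both
  survive the product rule of the cone.\<close>

lemma parts_in_cone:
  assumes "f \<in> pos_cone U" "e \<in> U"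
  shows "even_part e f \<in> pos_cone U \<and> odd_part e f \<in> pos_cone U"
  using assms(1)
proof induction
  case (rad e')
  then show ?case
    by (cases "e' = e") (auto simp: parts_rad intro: pos_cone.intros)
qed (auto simp: parts_const parts_add parts_mult intro!: pos_cone.intros)

lemma cone_at_top_nonneg: "f \<in> pos_cone U \<Longrightarrow> 0 \<le> f U"
  by (induction rule: pos_cone.induct) (auto simp: rad_def)

lemma sum_flip:
  assumes "e \<in> U"
  shows "(\<Sum>E\<in>Pow U. f (flip e E)) = (\<Sum>E\<in>Pow U. f E)"
  by (rule sum.reindex_bij_witness[where i = "flip e" and j = "flip e"])
     (use assms in \<open>auto simp: flip_flip\<close>, auto simp: flip_def split: if_splits)

text \<open>Averaging over one sign at a time keeps \<open>f\<close> in the cone, so the full average is the value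
  of a constant member of the cone.\<close>

lemma expect_cone_nonneg:
  assumes "finite U" "f \<in> pos_cone U"
  shows "0 \<le> expect U f"
proof -
  \<comment> \<open>Signs outside \<open>F\<close> are frozen at 1, their edges being present. For
    empty \<open>F\<close> this leaves the value at \<open>U\<close>, where all signs are 1;
    enlarging \<open>F\<close> by \<open>e\<close> replaces \<open>f\<close> by its even
    part.\<close>
  have "0 \<le> (\<Sum>E\<in>Pow F. f (E \<union> (U - F)))" if "finite F" "F \<subseteq> U" "f \<in> pos_cone U" for F f
    using that
  proof (induction F arbitrary: f rule: finite_induct)
    case empty
    then show ?case by (simp add: cone_at_top_nonneg)
  next
    case (insert e F)
    have disj: "Pow F \<inter> insert e ` Pow F = {}" using insert by auto
    have inj: "inj_on (insert e) (Pow F)"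
      using insert.hyps(2) by (intro inj_onI) (metis Diff_insert_absorb PowD subsetD)
    have "(\<Sum>E\<in>Pow (insert e F). f (E \<union> (U - insert e F))) =
      (\<Sum>E\<in>Pow F. f (E \<union> (U - insert e F)) + f (insert e E \<union> (U - insert e F)))"
      using insert.hyps disj inj
      by (simp add: Pow_insert sum.union_disjoint sum.reindex sum.distrib)
    also have "\<dots> = (\<Sum>E\<in>Pow F. 2 * even_part e f (E \<union> (U - F)))"
    proof (rule sum.cong[OF refl])
      fix E assume "E \<in> Pow F"
      then have 1: "insert e E \<union> (U - insert e F) = E \<union> (U - F)"
        and 2: "flip e (E \<union> (U - F)) = E \<union> (U - insert e F)"
        using insert by (auto simp: flip_def)
      show "f (E \<union> (U - insert e F)) + f (insert e E \<union> (U - insert e F)) =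
        2 * even_part e f (E \<union> (U - F))"
        unfolding even_part_def 1 2 by simp
    qed
    also have "\<dots> \<ge> 0"
      using insert.IH[of "even_part e f"] parts_in_cone[OF insert.prems(2), of e] insert.prems(1)
      by (simp flip: sum_distrib_left)
    finally show ?case .
  qed
  from this[of U f] assms show ?thesis by (simp add: expect_def)
qed

lemma expect_add: "expect U (\<lambda>E. f E + g E) = expect U f + expect U g"
  by (simp add: expect_def sum.distrib add_divide_distrib)

lemma expect_cmult: "expect U (\<lambda>E. c * f E) = c * expect U f"
  by (simp add: expect_def sum_distrib_left)

lemma expect_diff: "expect U (\<lambda>E. f E - g E) = expect U f - expect U g"
  by (simp add: expect_def sum_subtractf diff_divide_distrib)

lemma expect_sum: "expect U (\<lambda>E. \<Sum>i\<in>I. f i E) = (\<Sum>i\<in>I. expect U (f i))"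
  unfolding expect_def by (subst sum.swap) (simp add: sum_divide_distrib)

lemma expect_const: "finite U \<Longrightarrow> expect U (\<lambda>_. c) = c"
  by (simp add: expect_def card_Pow)

text \<open>The flip of \<open>e\<close> is a bijection of the sample space that negates
  \<open>rad e\<close> and fixes the even part, so their product averages to zero.\<close>

lemma expect_rad_mult:
  assumes "e \<in> U"
  shows "expect U (\<lambda>E. rad e E * f E) = expect U (\<lambda>E. rad e E * odd_part e f E)"
proof -
  have "(\<Sum>E\<in>Pow U. rad e E * even_part e f E) = (\<Sum>E\<in>Pow U. rad e (flip e E) * even_part e f (flip e E))"
    using sum_flip[OF assms, of "\<lambda>E. rad e E * even_part e f E"] by simp
  also have "\<dots> = - (\<Sum>E\<in>Pow U. rad e E * even_part e f E)"
    by (simp add: rad_flip even_part_def flip_flip add.commute sum_negf)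
  finally have "(\<Sum>E\<in>Pow U. rad e E * even_part e f E) = 0" by simp
  moreover have "rad e E * f E = rad e E * even_part e f E + rad e E * odd_part e f E" for E
    by (simp add: parts_sum[of f E e] distrib_left)
  ultimately show ?thesis by (simp add: expect_def sum.distrib)
qed

lemma cone_sum:
  assumes "\<And>i. i \<in> I \<Longrightarrow> f i \<in> pos_cone U"
  shows "(\<lambda>E. \<Sum>i\<in>I. f i E) \<in> pos_cone U"
  using assms
proof (induction I rule: infinite_finite_induct)
  case (insert x F)
  then show ?case using pos_cone.add[of "f x" U "\<lambda>E. \<Sum>i\<in>F. f i E"] by simp
qed (simp_all add: pos_cone.const)

lemma cone_cmult: "0 \<le> c \<Longrightarrow> f \<in> pos_cone U \<Longrightarrow> (\<lambda>E. c * f E) \<in> pos_cone U"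
  by (rule pos_cone.mult[OF pos_cone.const])

text \<open>\<open>f'\<close> plays the role of the formal derivative of \<open>f\<close> with respect to the sign \<open>rad e\<close>.
  The true discrete derivative \<open>rad e * odd_part e f\<close> has no Leibniz rule; up to an error in
  the cone it does.\<close>

definition dom_deriv :: "'a set \<Rightarrow> 'a \<Rightarrow> ('a set \<Rightarrow> real) \<Rightarrow> ('a set \<Rightarrow> real) \<Rightarrow> bool" where
  "dom_deriv U e f f' \<longleftrightarrow> f \<in> pos_cone U \<and> (\<lambda>E. f' E - rad e E * odd_part e f E) \<in> pos_cone U"

lemma dom_deriv_const: "0 \<le> c \<Longrightarrow> dom_deriv U e (\<lambda>_. c) (\<lambda>_. 0)"
  by (auto simp: dom_deriv_def parts_const intro: pos_cone.const)

lemma dom_deriv_rad: "e' \<in> U \<Longrightarrow> dom_deriv U e (rad e') (\<lambda>_. of_bool (e' = e))"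
  by (cases "e' = e") (auto simp: dom_deriv_def parts_rad rad_mult_self intro: pos_cone.const pos_cone.rad)

lemma dom_deriv_add:
  assumes "dom_deriv U e f f'" "dom_deriv U e g g'"
  shows "dom_deriv U e (\<lambda>E. f E + g E) (\<lambda>E. f' E + g' E)"
proof -
  have "(\<lambda>E. (f' E - rad e E * odd_part e f E) + (g' E - rad e E * odd_part e g E)) \<in> pos_cone U"
    using assms by (auto simp: dom_deriv_def intro: pos_cone.add)
  then show ?thesis
    using assms by (auto simp: dom_deriv_def parts_add algebra_simps intro: pos_cone.add)
qed

text \<open>The discrete derivative of a product is the Leibniz expression minus
  \<open>2 * rad e * odd_part e f * odd_part e g\<close>. This defect lies in the cone, so the
  Leibniz expression still dominates.\<close>

lemma dom_deriv_mult:
  assumes "e \<in> U" and f: "dom_deriv U e f f'" and g: "dom_deriv U e g g'"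
  shows "dom_deriv U e (\<lambda>E. f E * g E) (\<lambda>E. f' E * g E + f E * g' E)"
proof -
  have c: "f \<in> pos_cone U" "g \<in> pos_cone U" "rad e \<in> pos_cone U" "odd_part e f \<in> pos_cone U" "odd_part e g \<in> pos_cone U"
    using assms by (auto simp: dom_deriv_def parts_in_cone intro: pos_cone.rad)
  have "(\<lambda>E. ((f' E - rad e E * odd_part e f E) * g E + f E * (g' E - rad e E * odd_part e g E))
    + 2 * (rad e E * (odd_part e f E * odd_part e g E))) \<in> pos_cone U"
    using f g by (intro pos_cone.add pos_cone.mult cone_cmult c) (auto simp: dom_deriv_def)
  also have "(\<lambda>E. ((f' E - rad e E * odd_part e f E) * g E + f E * (g' E - rad e E * odd_part e g E))
    + 2 * (rad e E * (odd_part e f E * odd_part e g E)))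
    = (\<lambda>E. (f' E * g E + f E * g' E) - rad e E * odd_part e (\<lambda>E. f E * g E) E)" (is "?l = ?r")
  proof
    fix E
    show "?l E = ?r E"
      unfolding parts_mult parts_sum[of f E e] parts_sum[of g E e] by (simp add: algebra_simps)
  qed
  finally show ?thesis using c by (auto simp: dom_deriv_def intro: pos_cone.mult)
qed

lemma dom_deriv_sum:
  assumes "\<And>i. i \<in> I \<Longrightarrow> dom_deriv U e (f i) (f' i)"
  shows "dom_deriv U e (\<lambda>E. \<Sum>i\<in>I. f i E) (\<lambda>E. \<Sum>i\<in>I. f' i E)"
  using assms
proof (induction I rule: infinite_finite_induct)
  case (insert x F)
  then show ?case
    using dom_deriv_add[of U e "f x" "f' x" "\<lambda>E. \<Sum>i\<in>F. f i E" "\<lambda>E. \<Sum>i\<in>F. f' i E"] by simp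
qed (simp_all add: dom_deriv_const)

text \<open>Integration by parts: the left side is exactly the mean of the discrete derivative,
  which \<open>f'\<close> exceeds by a member of the cone.\<close>

lemma expect_rad_mult_le:
  assumes "finite U" "e \<in> U" "dom_deriv U e f f'"
  shows "expect U (\<lambda>E. rad e E * f E) \<le> expect U f'"
  using expect_cone_nonneg[of U "\<lambda>E. f' E - rad e E * odd_part e f E"] assms
  by (subst expect_rad_mult) (simp_all add: expect_diff dom_deriv_def)

section \<open>Traces of powers of the signed adjacency matrix\<close>

text \<open>With entries as plain real functions, an entry of a power is a sum of products, so cone
  membership and derivatives follow the recursion.\<close>

primrec mpow :: "nat \<Rightarrow> (nat \<Rightarrow> nat \<Rightarrow> real) \<Rightarrow> nat \<Rightarrow> nat \<Rightarrow> nat \<Rightarrow> real" where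
  "mpow n M 0 i j = of_bool (i = j)"
| "mpow n M (Suc k) i j = (\<Sum>c<n. M i c * mpow n M k c j)"

definition mtrace :: "nat \<Rightarrow> (nat \<Rightarrow> nat \<Rightarrow> real) \<Rightarrow> nat \<Rightarrow> real" where
  "mtrace n M k = (\<Sum>i<n. mpow n M k i i)"

lemma sum_of_bool_mult:
  fixes f :: "nat \<Rightarrow> real"
  assumes "i < n"
  shows "(\<Sum>c<n. of_bool (i = c) * f c) = f i" "(\<Sum>c<n. f c * of_bool (c = i)) = f i"
    "(\<Sum>c<n. of_bool (c = i) * f c) = f i" "(\<Sum>c<n. f c * of_bool (i = c)) = f i"
  using assms by (simp_all add: of_bool_def if_distrib if_distribR sum.delta' cong: if_cong)

lemma mpow_add:
  assumes "i < n"
  shows "mpow n M (k + l) i j = (\<Sum>c<n. mpow n M k i c * mpow n M l c j)"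
  using assms
proof (induction k arbitrary: i)
  case 0
  then show ?case by (simp add: sum_of_bool_mult)
next
  case (Suc k)
  have "mpow n M (Suc k + l) i j = (\<Sum>d<n. M i d * (\<Sum>c<n. mpow n M k d c * mpow n M l c j))"
    using Suc by simp
  also have "\<dots> = (\<Sum>c<n. (\<Sum>d<n. M i d * mpow n M k d c) * mpow n M l c j)"
    unfolding sum_distrib_left sum_distrib_right by (subst sum.swap) (simp add: mult.assoc)
  finally show ?case by simp
qed

lemma mpow_1: "j < n \<Longrightarrow> mpow n M (Suc 0) i j = M i j"
  by (simp add: sum_of_bool_mult)

lemma mpow_sym:
  assumes "\<And>i j. M i j = M j i" "i < n" "j < n"
  shows "mpow n M k i j = mpow n M k j i"
  using assms(2,3)
proof (induction k arbitrary: i j)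
  case 0
  then show ?case by auto
next
  case (Suc k)
  have "mpow n M (k + Suc 0) j i = (\<Sum>c<n. mpow n M k j c * mpow n M (Suc 0) c i)"
    by (rule mpow_add[OF Suc.prems(2)])
  also have "\<dots> = (\<Sum>c<n. M i c * mpow n M k c j)"
    using Suc by (intro sum.cong) (auto simp only: mpow_1 assms(1)[of i] lessThan_iff mult.commute)
  finally show ?case by simp
qed

lemma mtrace_0: "mtrace n M 0 = real n"
  by (simp add: mtrace_def)

lemma mtrace_add:
  "mtrace n M (k + l) = (\<Sum>i<n. \<Sum>j<n. mpow n M k i j * mpow n M l j i)"
  by (simp add: mtrace_def mpow_add)

text \<open>The squared Frobenius norm of the \<open>k\<close>-th power. It supplies the
  nonnegativity for Markov's inequality and later bounds the power applied to a vector.\<close>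

lemma mtrace_double:
  assumes "\<And>i j. M i j = M j i"
  shows "mtrace n M (2 * k) = (\<Sum>i<n. \<Sum>j<n. (mpow n M k i j)\<^sup>2)"
  unfolding mult_2 mtrace_add power2_eq_square
  by (intro sum.cong refl arg_cong2[where f = "(*)"] mpow_sym assms) auto

definition sign_mat :: "nat set set \<Rightarrow> nat \<Rightarrow> nat \<Rightarrow> real" where
  "sign_mat E i j = (if i = j then 0 else rad {Suc i, Suc j} E)"

definition all_edges :: "nat \<Rightarrow> nat set set" where
  "all_edges n = {e. e \<subseteq> {1..n} \<and> card e = 2}"

lemma finite_all_edges: "finite (all_edges n)"
  by (rule finite_subset[of _ "Pow {1..n}"]) (auto simp: all_edges_def)

lemma graphs_on_eq: "graphs_on n = Pow (all_edges n)"
  by (simp add: graphs_on_def all_edges_def)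

lemma edge_in_all_edges: "i < n \<Longrightarrow> j < n \<Longrightarrow> i \<noteq> j \<Longrightarrow> {Suc i, Suc j} \<in> all_edges n"
  by (auto simp: all_edges_def)

lemma sign_mat_sym: "sign_mat E i j = sign_mat E j i"
  by (simp add: sign_mat_def insert_commute)

abbreviation expct :: "nat \<Rightarrow> (nat set set \<Rightarrow> real) \<Rightarrow> real" where
  "expct n \<equiv> expect (all_edges n)"

abbreviation spow :: "nat \<Rightarrow> nat \<Rightarrow> nat \<Rightarrow> nat \<Rightarrow> nat set set \<Rightarrow> real" where
  "spow n k i j E \<equiv> mpow n (sign_mat E) k i j"

lemmas spow_sym = mpow_sym[OF sign_mat_sym]

definition strace :: "nat \<Rightarrow> nat \<Rightarrow> nat set set \<Rightarrow> real" where
  "strace n k E = mtrace n (sign_mat E) k"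

definition straces :: "nat \<Rightarrow> nat list \<Rightarrow> nat set set \<Rightarrow> real" where
  "straces n ks E = (\<Prod>k\<leftarrow>ks. strace n k E)"

lemma straces_simps [simp]:
  "straces n [] E = 1" "straces n (k # ks) E = strace n k E * straces n ks E"
  "straces n (ks @ ls) E = straces n ks E * straces n ls E"
  by (simp_all add: straces_def)

lemma sign_mat_in_cone: "a < n \<Longrightarrow> b < n \<Longrightarrow> (\<lambda>E. sign_mat E a b) \<in> pos_cone (all_edges n)"
  using pos_cone.rad[OF edge_in_all_edges] pos_cone.const[of 0 "all_edges n"]
  by (cases "a = b") (auto simp: sign_mat_def)

lemma spow_in_cone:
  "a < n \<Longrightarrow> b < n \<Longrightarrow> spow n k a b \<in> pos_cone (all_edges n)"
proof (induction k arbitrary: a)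
  case 0
  then show ?case by (auto intro: pos_cone.const)
next
  case (Suc k)
  then show ?case by (auto intro!: cone_sum pos_cone.mult sign_mat_in_cone)
qed

lemma strace_in_cone: "strace n k \<in> pos_cone (all_edges n)"
  using cone_sum[of "{..<n}" "\<lambda>i. spow n k i i"]
  by (simp add: strace_def[abs_def] mtrace_def spow_in_cone)

lemma straces_in_cone: "straces n ks \<in> pos_cone (all_edges n)"
proof (induction ks)
  case Nil
  then show ?case using pos_cone.const[of 1] by (simp add: straces_def[abs_def])
next
  case (Cons k ks)
  then show ?case using pos_cone.mult[OF strace_in_cone] by (simp add: straces_def[abs_def])
qed

lemma strace_double_nonneg: "0 \<le> strace n (2 * k) E"
  unfolding strace_def mtrace_double[OF sign_mat_sym] by (intro sum_nonneg) auto

primrec straces_deriv :: "nat \<Rightarrow> nat \<Rightarrow> nat \<Rightarrow> nat list \<Rightarrow> nat set set \<Rightarrow> real" where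
  "straces_deriv n i j [] E = 0"
| "straces_deriv n i j (k # ks) E =
    2 * real k * spow n (k - 1) i j E * straces n ks E + strace n k E * straces_deriv n i j ks E"

context
  fixes n i j :: nat
  assumes ij: "i < n" "j < n" "i \<noteq> j"
begin

lemma dom_deriv_sign_mat:
  assumes "a < n" "b < n"
  shows "dom_deriv (all_edges n) {Suc i, Suc j} (\<lambda>E. sign_mat E a b)
    (\<lambda>_. of_bool (a = i \<and> b = j) + of_bool (a = j \<and> b = i))"
proof (cases "a = b")
  case True
  then show ?thesis using dom_deriv_const[of 0] ij by (auto simp: sign_mat_def)
next
  case False
  have "of_bool (a = i \<and> b = j) + of_bool (a = j \<and> b = i) = (of_bool ({Suc a, Suc b} = {Suc i, Suc j}) :: real)"
    using ij by (auto simp: doubleton_eq_iff)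
  then show ?thesis
    using dom_deriv_rad[OF edge_in_all_edges[OF assms False]] False by (simp add: sign_mat_def)
qed

text \<open>Leibniz rule over the position of the differentiated factor, with \<open>t\<close>
  factors before it. An edge occupies two entries of the matrix, hence two summands.\<close>

lemma dom_deriv_spow:
  assumes "a < n" "b < n"
  shows "dom_deriv (all_edges n) {Suc i, Suc j} (spow n k a b)
    (\<lambda>E. \<Sum>t<k. spow n t a i E * spow n (k - 1 - t) j b E + spow n t a j E * spow n (k - 1 - t) i b E)"
  using assms
proof (induction k arbitrary: a)
  case 0
  then show ?case by (auto intro: dom_deriv_const)
next
  case (Suc k)
  let ?D = "\<lambda>a E. \<Sum>t<k. spow n t a i E * spow n (k - 1 - t) j b E
    + spow n t a j E * spow n (k - 1 - t) i b E"
  have D: "dom_deriv (all_edges n) {Suc i, Suc j} (\<lambda>E. \<Sum>c<n. sign_mat E a c * spow n k c b E)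
    (\<lambda>E. \<Sum>c<n. (of_bool (a = i \<and> c = j) + of_bool (a = j \<and> c = i)) * spow n k c b E
      + sign_mat E a c * ?D c E)"
    using Suc ij
    by (intro dom_deriv_sum dom_deriv_mult dom_deriv_sign_mat Suc.IH edge_in_all_edges) auto
  have eq: "(\<Sum>c<n. (of_bool (a = i \<and> c = j) + of_bool (a = j \<and> c = i)) * spow n k c b E
      + sign_mat E a c * ?D c E) = (\<Sum>t<Suc k. spow n t a i E * spow n (Suc k - 1 - t) j b E
    + spow n t a j E * spow n (Suc k - 1 - t) i b E)" for E
  proof -
    \<comment> \<open>Differentiating the first factor gives the summand \<open>t = 0\<close>; the
      induction hypothesis gives the others, with \<open>t\<close> shifted by one.\<close>
    have d: "(\<Sum>c<n. (of_bool (a = i \<and> c = j) + of_bool (a = j \<and> c = i)) * spow n k c b E)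
      = of_bool (a = i) * spow n k j b E + of_bool (a = j) * spow n k i b E"
      using ij by (simp add: of_bool_conj distrib_right mult.assoc sum.distrib sum_of_bool_mult
          flip: sum_distrib_left)
    have s: "(\<Sum>c<n. sign_mat E a c * ?D c E) =
      (\<Sum>t<k. spow n (Suc t) a i E * spow n (k - 1 - t) j b E
        + spow n (Suc t) a j E * spow n (k - 1 - t) i b E)"
      unfolding sum_distrib_left
      by (subst sum.swap) (simp add: sum_distrib_right distrib_left mult.assoc sum.distrib)
    show ?thesis
      unfolding sum.lessThan_Suc_shift by (subst sum.distrib) (simp only: d s, simp)
  qed
  show ?case using D by (simp only: eq mpow.simps(2))
qed

text \<open>By cyclicity each of the \<open>k\<close> positions leaves the same entry of the power
  \<open>k - 1\<close>; the 2 stands for the two orientations of the edge, equal by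
  symmetry.\<close>

lemma dom_deriv_strace:
  "dom_deriv (all_edges n) {Suc i, Suc j} (strace n k) (\<lambda>E. 2 * real k * spow n (k - 1) i j E)"
proof -
  have "dom_deriv (all_edges n) {Suc i, Suc j} (\<lambda>E. \<Sum>a<n. spow n k a a E)
    (\<lambda>E. \<Sum>a<n. \<Sum>t<k. spow n t a i E * spow n (k - 1 - t) j a E + spow n t a j E * spow n (k - 1 - t) i a E)"
    by (intro dom_deriv_sum dom_deriv_spow) auto
  moreover have "(\<Sum>a<n. \<Sum>t<k. spow n t a i E * spow n (k - 1 - t) j a E + spow n t a j E * spow n (k - 1 - t) i a E)
    = 2 * real k * spow n (k - 1) i j E" for E
  proof -
    have *: "(\<Sum>a<n. spow n t a x E * spow n (k - 1 - t) y a E) = spow n (k - 1) i j E"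
      if "t < k" "(x, y) = (i, j) \<or> (x, y) = (j, i)" for t x y
    proof -
      have "(\<Sum>a<n. spow n t a x E * spow n (k - 1 - t) y a E) = spow n (k - 1 - t + t) y x E"
        using ij that by (subst mpow_add) (auto simp: mult.commute)
      with that ij show ?thesis by (auto simp: spow_sym[of j])
    qed
    show ?thesis
      by (subst sum.swap) (simp add: sum.distrib *[simplified])
  qed
  ultimately show ?thesis by (simp add: strace_def[abs_def] mtrace_def)
qed

lemma dom_deriv_straces:
  "dom_deriv (all_edges n) {Suc i, Suc j} (straces n ks) (straces_deriv n i j ks)"
proof (induction ks)
  case Nil
  then show ?case using dom_deriv_const[of 1] by (simp add: straces_def[abs_def])
next
  case (Cons k ks)
  then show ?case
    using dom_deriv_mult[OF edge_in_all_edges[OF ij] dom_deriv_strace Cons] by simp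
qed

end

lemma straces_deriv_in_cone:
  assumes "i < n" "j < n"
  shows "straces_deriv n i j ks \<in> pos_cone (all_edges n)"
proof (induction ks)
  case Nil
  then show ?case using pos_cone.const[of 0] by simp
next
  case (Cons k ks)
  have "(\<lambda>E. (2 * real k) * spow n (k - 1) i j E * straces n ks E + strace n k E * straces_deriv n i j ks E)
    \<in> pos_cone (all_edges n)"
    by (intro pos_cone.add pos_cone.mult cone_cmult spow_in_cone strace_in_cone straces_in_cone Cons assms) simp
  then show ?case by simp
qed

text \<open>Differentiating \<open>Tr S^l\<close> opens it into \<open>2 l\<close> copies of an
  entry of \<open>S^(l-1)\<close>. Contraction with an entry of \<open>S^k\<close> closes each of
  them to one trace of exponent \<open>k + l - 1\<close>, so two traces merge.\<close>

primrec merged_traces :: "nat \<Rightarrow> nat \<Rightarrow> nat list \<Rightarrow> nat set set \<Rightarrow> real" where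
  "merged_traces n k [] E = 0"
| "merged_traces n k (l # ls) E =
    2 * real l * strace n (k + (l - 1)) E * straces n ls E + strace n l E * merged_traces n k ls E"

lemma sum_spow_straces_deriv:
  "(\<Sum>i<n. \<Sum>j<n. spow n k j i E * straces_deriv n i j ks E) = merged_traces n k ks E"
proof (induction ks)
  case Nil
  then show ?case by simp
next
  case (Cons l ls)
  have "(\<Sum>i<n. \<Sum>j<n. spow n k j i E * spow n (l - 1) i j E) = strace n (k + (l - 1)) E"
    unfolding strace_def mtrace_add by (subst sum.swap) simp
  then have "2 * real l * strace n (k + (l - 1)) E * straces n ls E =
    2 * real l * (\<Sum>i<n. \<Sum>j<n. spow n k j i E * spow n (l - 1) i j E) * straces n ls E"
    by simp
  then have 1: "(\<Sum>i<n. \<Sum>j<n. spow n k j i E * (2 * real l * spow n (l - 1) i j E * straces n ls E))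
    = 2 * real l * strace n (k + (l - 1)) E * straces n ls E"
    by (simp add: sum_distrib_left sum_distrib_right mult_ac)
  have 2: "(\<Sum>i<n. \<Sum>j<n. spow n k j i E * (strace n l E * straces_deriv n i j ls E))
    = strace n l E * merged_traces n k ls E"
    unfolding Cons.IH[symmetric] by (simp add: sum_distrib_left mult_ac)
  show ?case
    unfolding straces_deriv.simps merged_traces.simps distrib_left sum.distrib 1 2 ..
qed

text \<open>Diagonal entries vanish, so there only \<open>0 <= expct n f'\<close> is at stake.
  Including them lets all later sums run over full index squares.\<close>

lemma expct_sign_mat_mult_le:
  assumes "i < n" "j < n" and "0 \<le> expct n f'"
    and "i \<noteq> j \<Longrightarrow> dom_deriv (all_edges n) {Suc i, Suc j} f f'"
  shows "expct n (\<lambda>E. sign_mat E i j * f E) \<le> expct n f'"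
proof (cases "i = j")
  case True
  then show ?thesis
    using assms(3) by (simp add: sign_mat_def expect_const[OF finite_all_edges])
next
  case False
  with expect_rad_mult_le[OF finite_all_edges edge_in_all_edges[OF assms(1,2) False]] assms(4)
  show ?thesis by (simp add: sign_mat_def)
qed

text \<open>The loop equation of Gaussian matrices holds for sign matrices as an inequality: expand one
  factor of the first trace and differentiate the rest.\<close>

lemma loop_inequality:
  "expct n (straces n (Suc k # ks)) \<le>
    (\<Sum>t<k. expct n (straces n (t # (k - 1 - t) # ks)))
    + real k * expct n (straces n ((k - 1) # ks)) + expct n (merged_traces n k ks)"
proof -
  let ?U = "all_edges n"
  \<comment> \<open>Derivative of \<open>spow n k j i\<close>. In the first summand both pieces lead
    from \<open>j\<close> to \<open>i\<close>, and a transposition joins them to one trace; in the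
    second they close up separately to a product of two traces.\<close>
  define P where "P i j E = (\<Sum>t<k. spow n t j i E * spow n (k - 1 - t) j i E
    + spow n t j j E * spow n (k - 1 - t) i i E)" for i j E
  define D where "D i j E = P i j E * straces n ks E + spow n k j i E * straces_deriv n i j ks E" for i j E
  have "straces n (Suc k # ks) =
    (\<lambda>E. \<Sum>i<n. \<Sum>j<n. sign_mat E i j * (spow n k j i E * straces n ks E))"
    by (simp add: strace_def mtrace_def sum_distrib_right mult.assoc fun_eq_iff)
  then have "expct n (straces n (Suc k # ks)) = (\<Sum>i<n. \<Sum>j<n. expct n (\<lambda>E. sign_mat E i j * (spow n k j i E * straces n ks E)))"
    by (simp only: expect_sum)
  also have "\<dots> \<le> (\<Sum>i<n. \<Sum>j<n. expct n (D i j))"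
  proof (intro sum_mono expct_sign_mat_mult_le)
    fix i j assume "i \<in> {..<n}" "j \<in> {..<n}"
    then have ij: "i < n" "j < n" by auto
    show "0 \<le> expct n (D i j)"
      unfolding D_def[abs_def] P_def
      by (intro expect_cone_nonneg finite_all_edges pos_cone.add pos_cone.mult cone_sum spow_in_cone
          straces_in_cone straces_deriv_in_cone ij)
    show "dom_deriv ?U {Suc i, Suc j} (\<lambda>E. spow n k j i E * straces n ks E) (D i j)" if "i \<noteq> j"
      unfolding D_def[abs_def] P_def
      by (intro dom_deriv_mult dom_deriv_spow dom_deriv_straces edge_in_all_edges ij that)
  qed auto
  also have "\<dots> = expct n (\<lambda>E. \<Sum>i<n. \<Sum>j<n. D i j E)"
    by (simp add: expect_sum)
  also have "(\<lambda>E. \<Sum>i<n. \<Sum>j<n. D i j E) = (\<lambda>E. (\<Sum>t<k. straces n (t # (k - 1 - t) # ks) E)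
    + real k * straces n ((k - 1) # ks) E + merged_traces n k ks E)"
  proof
    fix E
    have 1: "(\<Sum>i<n. \<Sum>j<n. spow n t j i E * spow n (k - 1 - t) j i E) = strace n (k - 1) E" if "t < k" for t
    proof -
      have "(\<Sum>i<n. \<Sum>j<n. spow n t j i E * spow n (k - 1 - t) j i E)
        = (\<Sum>i<n. \<Sum>j<n. spow n t i j E * spow n (k - 1 - t) j i E)"
        by (intro sum.cong refl arg_cong2[where f = "(*)"] spow_sym) auto
      also have "\<dots> = strace n (t + (k - 1 - t)) E" unfolding strace_def mtrace_add ..
      finally show ?thesis using that by simp
    qed
    have 2: "(\<Sum>i<n. \<Sum>j<n. spow n t j j E * spow n (k - 1 - t) i i E) = strace n t E * strace n (k - 1 - t) E" for t
      unfolding strace_def mtrace_def sum_product by (subst sum.swap) simp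
    have "(\<Sum>i<n. \<Sum>j<n. P i j E) = (\<Sum>i<n. \<Sum>t<k. \<Sum>j<n. spow n t j i E * spow n (k - 1 - t) j i E
      + spow n t j j E * spow n (k - 1 - t) i i E)"
      unfolding P_def by (intro sum.cong refl sum.swap)
    also have "\<dots> = (\<Sum>t<k. \<Sum>i<n. \<Sum>j<n. spow n t j i E * spow n (k - 1 - t) j i E
      + spow n t j j E * spow n (k - 1 - t) i i E)"
      by (rule sum.swap)
    also have "\<dots> = (\<Sum>t<k. strace n (k - 1) E + strace n t E * strace n (k - 1 - t) E)"
      by (intro sum.cong refl) (simp only: sum.distrib 1 2 lessThan_iff)
    also have "\<dots> = real k * strace n (k - 1) E + (\<Sum>t<k. strace n t E * strace n (k - 1 - t) E)"
      by (simp add: sum.distrib)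
    finally have P: "(\<Sum>i<n. \<Sum>j<n. P i j E) = \<dots>" .
    have "(\<Sum>i<n. \<Sum>j<n. D i j E) = (\<Sum>i<n. \<Sum>j<n. P i j E) * straces n ks E + merged_traces n k ks E"
      unfolding D_def sum.distrib sum_spow_straces_deriv sum_distrib_right ..
    then show "(\<Sum>i<n. \<Sum>j<n. D i j E) = (\<Sum>t<k. straces n (t # (k - 1 - t) # ks) E)
      + real k * straces n ((k - 1) # ks) E + merged_traces n k ks E"
      unfolding P by (simp add: distrib_right sum_distrib_right mult.assoc)
  qed
  finally show ?thesis
    unfolding expect_add expect_sum expect_cmult .
qed

text \<open>For \<open>\<nu> = 0\<close> this is the moment sequence of the semicircle law. The summand \<open>\<nu>\<close> absorbs the
  lower-order terms of the loop inequality and also bounds the sequence from below, which controls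
  the terms where two traces merge.\<close>

fun catalan_like :: "real \<Rightarrow> real \<Rightarrow> nat \<Rightarrow> real" where
  "catalan_like q \<nu> 0 = 1"
| "catalan_like q \<nu> (Suc 0) = \<nu>"
| "catalan_like q \<nu> (Suc (Suc k)) = \<nu> + q * (\<Sum>t\<le>k. catalan_like q \<nu> t * catalan_like q \<nu> (k - t))"

lemma catalan_like_ge:
  assumes "0 \<le> q" "0 \<le> \<nu>" "\<nu> \<le> 1"
  shows "\<nu> \<le> catalan_like q \<nu> k"
proof (induction k rule: less_induct)
  case (less k)
  show ?case
  proof (cases "k < 2")
    case True
    then have "k = 0 \<or> k = Suc 0" by auto
    then show ?thesis using assms by auto
  next
    case False
    then obtain m where m: "k = Suc (Suc m)" by (metis One_nat_def Suc_1 add_2_eq_Suc le_Suc_ex not_less)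
    have "0 \<le> catalan_like q \<nu> t" if "t \<le> m" for t
      using less[of t] that assms m by auto
    then show ?thesis using m assms by (auto intro!: sum_nonneg mult_nonneg_nonneg)
  qed
qed

text \<open>A truncated generating function at 1. If a shorter partial sum is at most 2, the
  convolutions add up to at most 4, and the recursion returns \<open>1 + L \<nu> + 4 q\<close>,
  again at most 2. The value 2 is the solution of \<open>x = 1 + q x^2\<close> at the critical
  \<open>q = 1/4\<close>.\<close>

lemma sum_catalan_like_le:
  assumes "0 \<le> q" "0 \<le> \<nu>" "\<nu> \<le> 1" "real L * \<nu> + 4 * q \<le> 1" "K \<le> L"
  shows "(\<Sum>k\<le>K. catalan_like q \<nu> k) \<le> 2"
  using assms(5)
proof (induction K rule: less_induct)
  case (less K)
  let ?h = "catalan_like q \<nu>"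
  have h0: "0 \<le> ?h k" for k
    using catalan_like_ge[OF assms(1-3), of k] assms(2) by linarith
  show ?case
  proof (cases "K < 2")
    case True
    then have "K = 0 \<or> K = Suc 0" by auto
    then show ?thesis using assms by auto
  next
    case False
    then obtain m where m: "K = Suc (Suc m)" by (metis One_nat_def Suc_1 add_2_eq_Suc le_Suc_ex not_less)
    have "(\<Sum>k\<le>m. \<Sum>t\<le>k. ?h t * ?h (k - t)) = (\<Sum>(i,j)\<in>{(i,j). i + j \<le> m}. ?h i * ?h j)"
      by (simp add: sum.triangle_reindex_eq)
    also have "\<dots> \<le> (\<Sum>(i,j)\<in>{..m} \<times> {..m}. ?h i * ?h j)"
      by (rule sum_mono2) (auto intro: mult_nonneg_nonneg h0)
    also have "\<dots> = (\<Sum>k\<le>m. ?h k) * (\<Sum>k\<le>m. ?h k)"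
      by (simp add: sum_product sum.cartesian_product)
    also have "\<dots> \<le> 2 * 2"
      using less.IH[of m] less.prems m by (intro mult_mono sum_nonneg h0) auto
    finally have c: "q * (\<Sum>k\<le>m. \<Sum>t\<le>k. ?h t * ?h (k - t)) \<le> 4 * q"
      using assms(1) mult_left_mono by fastforce
    have "(\<Sum>k\<le>K. ?h k) = 1 + \<nu> + (\<Sum>k\<le>m. ?h (Suc (Suc k)))"
      unfolding m by (simp only: sum.atMost_Suc_shift catalan_like.simps(1,2) add.assoc)
    also have "\<dots> = 1 + real K * \<nu> + q * (\<Sum>k\<le>m. \<Sum>t\<le>k. ?h t * ?h (k - t))"
      using m by (simp add: sum.distrib sum_distrib_left algebra_simps)
    also have "\<dots> \<le> 1 + real L * \<nu> + 4 * q"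
      using c less.prems assms(2) by (intro add_mono mult_right_mono) auto
    finally show ?thesis using assms(4) by linarith
  qed
qed

text \<open>The split terms of the loop inequality reproduce the convolution in
  \<open>catalan_like\<close>. The transposed and the merged terms are smaller by factors that
  \<open>err_le\<close> fits into the summand \<open>\<nu>\<close> of that recursion.\<close>

lemma expct_straces_le:
  fixes n L :: nat and s \<nu> :: real
  defines "q \<equiv> real n / s\<^sup>2"
  defines "G \<equiv> \<lambda>k. real n * s ^ k * catalan_like q \<nu> k"
  assumes n: "0 < n" and s: "0 < s" and \<nu>: "0 < \<nu>" "\<nu> \<le> 1"
    and sum_le: "real L * \<nu> + 4 * q \<le> 1"
    and err_le: "2 * real L / s\<^sup>2 + 4 * real L / (\<nu> * real n * s\<^sup>2) \<le> \<nu>"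
    and ks: "sum_list ks \<le> L"
  shows "expct n (straces n ks) \<le> (\<Prod>k\<leftarrow>ks. G k)"
  using ks
\<comment> \<open>Splitting lowers the sum by two but lengthens the list by one, and dropping an
  exponent 0 lowers only the length; the combined measure decreases in all cases.\<close>
proof (induction "sum_list ks + length ks" arbitrary: ks rule: less_induct)
  case less
  let ?h = "catalan_like q \<nu>"
  let ?G = "\<lambda>ks. \<Prod>k\<leftarrow>ks. G k"
  have q: "0 \<le> q" by (simp add: q_def)
  note ge = catalan_like_ge[OF q less_imp_le[OF \<nu>(1)] \<nu>(2)]
  have h0: "0 < ?h k" for k using ge[of k] \<nu> by linarith
  have h2: "?h k \<le> 2" if "k \<le> L" for k
  proof -
    have "?h k \<le> sum ?h {..k}"
      by (rule member_le_sum) (simp_all add: less_imp_le[OF h0])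
    also have "\<dots> \<le> 2"
      by (rule sum_catalan_like_le[OF q less_imp_le[OF \<nu>(1)] \<nu>(2) sum_le that])
    finally show ?thesis .
  qed
  have G0: "0 < G k" for k using n s h0 by (simp add: G_def)
  have PG0: "0 < ?G ks" for ks using G0 by (induction ks) auto
  show ?case
  proof (cases ks)
    case Nil
    then show ?thesis by (simp add: expect_const finite_all_edges straces_def[abs_def])
  next
    case (Cons k0 ls)
    show ?thesis
    proof (cases k0)
      case 0
      have "straces n ks = (\<lambda>E. real n * straces n ls E)"
        by (simp add: Cons 0 strace_def mtrace_0 fun_eq_iff)
      then have "expct n (straces n ks) = real n * expct n (straces n ls)"
        by (simp only: expect_cmult)
      also have "\<dots> \<le> real n * ?G ls"
        using less.hyps[of ls] less.prems Cons 0 by (intro mult_left_mono) auto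
      finally show ?thesis by (simp add: Cons 0 G_def)
    next
      case (Suc k)
      \<comment> \<open>Cost of a merge: \<open>2 * G (k + l')\<close> is at most
        \<open>4 n s^(k+l')\<close> and \<open>G l\<close> is at least \<open>n s^l \<nu>\<close>,
        where \<open>l = l' + 1\<close>. The quotient is \<open>4 s^(k-1) / \<nu>\<close>, written
        here so that \<open>k = 0\<close> makes sense.\<close>
      define c where "c = 4 * s ^ Suc k / (\<nu> * s\<^sup>2)"
      have c: "0 < c" using s \<nu> by (simp add: c_def)
      \<comment> \<open>The prefix \<open>ps\<close> collects the traces already passed, so that the
        outer hypothesis applies to the whole list; the weights of the possible merges add up to
        \<open>sum_list ms\<close>.\<close>
      have merge: "expct n (\<lambda>E. straces n ps E * merged_traces n k ms E)
          \<le> c * real (sum_list ms) * ?G ps * ?G ms"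
        if "sum_list ps + sum_list ms = sum_list ls" "length ps + length ms = length ls" for ps ms
        using that
      proof (induction ms arbitrary: ps)
        case Nil
        then show ?case by (simp add: expect_const finite_all_edges)
      next
        case (Cons l ms)
        have a: "2 * real l * expct n (straces n (ps @ (k + (l - 1)) # ms))
          \<le> c * real l * ?G ps * ?G (l # ms)"
        proof (cases "l = 0")
          case True
          then show ?thesis by simp
        next
          case False
          then obtain l' where l: "l = Suc l'" by (cases l) auto
          have "expct n (straces n (ps @ (k + (l - 1)) # ms)) \<le> ?G (ps @ (k + (l - 1)) # ms)"
            using less.hyps[of "ps @ (k + (l - 1)) # ms"] less.prems Cons.prems \<open>ks = k0 # ls\<close> Suc l by auto
          also have "\<dots> = ?G ps * ?G ms * G (k + l')" by (simp add: l)
          finally have 1: "expct n (straces n (ps @ (k + (l - 1)) # ms)) \<le> ?G ps * ?G ms * G (k + l')" .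
          have "G (k + l') \<le> real n * s ^ (k + l') * 2"
            unfolding G_def using h2[of "k + l'"] less.prems Cons.prems \<open>ks = k0 # ls\<close> Suc l s
            by (intro mult_left_mono) auto
          then have "2 * G (k + l') \<le> 4 * (real n * s ^ (k + l'))" by simp
          also have "\<dots> = c * (real n * s ^ l * \<nu>)"
            using s \<nu> by (simp add: c_def l power2_eq_square power_add field_simps)
          also have "\<dots> \<le> c * G l"
            unfolding G_def using c ge[of l] s by (intro mult_left_mono) auto
          finally have 2: "2 * G (k + l') \<le> c * G l" .
          have "2 * real l * expct n (straces n (ps @ (k + (l - 1)) # ms))
            \<le> 2 * real l * (?G ps * ?G ms * G (k + l'))"
            using 1 by (intro mult_left_mono) auto
          also have "\<dots> = real l * ?G ps * ?G ms * (2 * G (k + l'))" by simp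
          also have "\<dots> \<le> real l * ?G ps * ?G ms * (c * G l)"
            using 2 PG0[of ps] PG0[of ms] by (intro mult_left_mono) auto
          finally show ?thesis by (simp add: mult_ac)
        qed
        have b: "expct n (\<lambda>E. straces n (ps @ [l]) E * merged_traces n k ms E)
          \<le> c * real (sum_list ms) * ?G (ps @ [l]) * ?G ms"
          using Cons.prems by (intro Cons.IH) auto
        have "expct n (\<lambda>E. straces n ps E * merged_traces n k (l # ms) E) =
          expct n (\<lambda>E. 2 * real l * straces n (ps @ (k + (l - 1)) # ms) E
            + straces n (ps @ [l]) E * merged_traces n k ms E)"
          by (simp add: algebra_simps)
        also have "\<dots> = 2 * real l * expct n (straces n (ps @ (k + (l - 1)) # ms))
          + expct n (\<lambda>E. straces n (ps @ [l]) E * merged_traces n k ms E)"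
          unfolding expect_add expect_cmult ..
        also have "\<dots> \<le> c * real l * ?G ps * ?G (l # ms) + c * real (sum_list ms) * ?G (ps @ [l]) * ?G ms"
          by (rule add_mono[OF a b])
        also have "\<dots> = c * real (sum_list (l # ms)) * ?G ps * ?G (l # ms)"
          by (simp add: algebra_simps)
        finally show ?case .
      qed
      define X where "X = real n * s ^ Suc k"
      have kL: "Suc k \<le> L" "sum_list ls \<le> L" using less.prems Cons Suc by auto
      have split: "(\<Sum>t<k. expct n (straces n (t # (k - 1 - t) # ls)))
          \<le> X * (q * (\<Sum>t<k. ?h t * ?h (k - 1 - t))) * ?G ls"
      proof -
        have "(\<Sum>t<k. expct n (straces n (t # (k - 1 - t) # ls))) \<le> (\<Sum>t<k. X * (q * (?h t * ?h (k - 1 - t))) * ?G ls)"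
        proof (rule sum_mono)
          fix t assume "t \<in> {..<k}"
          then obtain d where d: "k = Suc (t + d)" using less_imp_Suc_add[of t k] by auto
          have "expct n (straces n (t # (k - 1 - t) # ls)) \<le> ?G (t # (k - 1 - t) # ls)"
            using less.hyps[of "t # (k - 1 - t) # ls"] less.prems Cons Suc d by auto
          also have "\<dots> = X * (q * (?h t * ?h (k - 1 - t))) * ?G ls"
            using s by (simp add: G_def X_def q_def d power_add power2_eq_square)
          finally show "expct n (straces n (t # (k - 1 - t) # ls)) \<le> \<dots>" .
        qed
        then show ?thesis by (simp add: sum_distrib_left sum_distrib_right)
      qed
      have diag: "real k * expct n (straces n ((k - 1) # ls)) \<le> X * (2 * real L / s\<^sup>2) * ?G ls"
      proof (cases k)
        case 0
        then show ?thesis using s PG0[of ls] by (simp add: X_def)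
      next
        case (Suc k')
        have "expct n (straces n ((k - 1) # ls)) \<le> ?G ((k - 1) # ls)"
          using less.hyps[of "(k - 1) # ls"] less.prems Cons \<open>k0 = Suc k\<close> by auto
        also have "\<dots> \<le> real n * s ^ k' * 2 * ?G ls"
          using h2[of k'] kL Suc s PG0[of ls] by (auto simp: G_def intro!: mult_right_mono mult_left_mono)
        finally have "real k * expct n (straces n ((k - 1) # ls)) \<le> real L * (real n * s ^ k' * 2 * ?G ls)"
          using kL s PG0[of ls] by (intro mult_mono') (auto intro!: expect_cone_nonneg finite_all_edges straces_in_cone)
        also have "\<dots> = X * (2 * real L / s\<^sup>2) * ?G ls"
          using s by (simp add: X_def Suc power2_eq_square)
        finally show ?thesis .
      qed
      have mrg: "expct n (merged_traces n k ls) \<le> X * (4 * real L / (\<nu> * real n * s\<^sup>2)) * ?G ls"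
      proof -
        have "expct n (merged_traces n k ls) \<le> c * real (sum_list ls) * ?G ls"
          using merge[of "[]" ls] by simp
        also have "\<dots> \<le> c * real L * ?G ls"
          using kL c PG0[of ls] by (intro mult_right_mono mult_left_mono) auto
        also have "c * real L = X * (4 * real L / (\<nu> * real n * s\<^sup>2))"
          using n by (simp add: c_def X_def)
        finally show ?thesis .
      qed
      have rec: "?h (Suc k) = \<nu> + q * (\<Sum>t<k. ?h t * ?h (k - 1 - t))"
        by (cases k) (simp_all add: lessThan_Suc_atMost)
      have "expct n (straces n ks) \<le> X * (q * (\<Sum>t<k. ?h t * ?h (k - 1 - t))) * ?G ls
        + X * (2 * real L / s\<^sup>2) * ?G ls + X * (4 * real L / (\<nu> * real n * s\<^sup>2)) * ?G ls"
        unfolding Cons Suc by (intro order.trans[OF loop_inequality] add_mono split diag mrg)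
      also have "\<dots> = X * ?G ls * (q * (\<Sum>t<k. ?h t * ?h (k - 1 - t))
        + (2 * real L / s\<^sup>2 + 4 * real L / (\<nu> * real n * s\<^sup>2)))"
        by (simp add: algebra_simps)
      also have "\<dots> \<le> X * ?G ls * ?h (Suc k)"
        unfolding rec using err_le n s PG0[of ls] by (intro mult_left_mono) (auto simp: X_def)
      also have "\<dots> = ?G ks" by (simp add: Cons Suc G_def X_def)
      finally show ?thesis .
    qed
  qed
qed

section \<open>Row sums\<close>

definition row_sum :: "nat \<Rightarrow> nat \<Rightarrow> nat set set \<Rightarrow> real" where
  "row_sum n a E = (\<Sum>c<n. sign_mat E a c)"

definition total_sum :: "nat \<Rightarrow> nat set set \<Rightarrow> real" where
  "total_sum n E = (\<Sum>a<n. row_sum n a E)"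

text \<open>The squared length of \<open>S\<close> applied to the all-ones vector. Its concentration
  at \<open>n^2\<close> is the origin of the 1/4 in 5/4.\<close>

definition row_square_sum :: "nat \<Rightarrow> nat set set \<Rightarrow> real" where
  "row_square_sum n E = (\<Sum>a<n. row_sum n a E * row_sum n a E)"

lemma row_sum_in_cone: "a < n \<Longrightarrow> row_sum n a \<in> pos_cone (all_edges n)"
  using cone_sum[of "{..<n}" "\<lambda>c E. sign_mat E a c"]
  by (simp add: row_sum_def[abs_def] sign_mat_in_cone)

lemma row_square_sum_in_cone: "row_square_sum n \<in> pos_cone (all_edges n)"
  using cone_sum[of "{..<n}" "\<lambda>a E. row_sum n a E * row_sum n a E"]
  by (simp add: row_square_sum_def[abs_def] row_sum_in_cone pos_cone.mult)

context
  fixes n i j :: nat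
  assumes ij: "i < n" "j < n" "i \<noteq> j"
begin

lemma dom_deriv_row_sum:
  assumes "a < n"
  shows "dom_deriv (all_edges n) {Suc i, Suc j} (row_sum n a) (\<lambda>_. of_bool (a = i) + of_bool (a = j))"
proof -
  have "dom_deriv (all_edges n) {Suc i, Suc j} (\<lambda>E. \<Sum>c<n. sign_mat E a c)
    (\<lambda>_. \<Sum>c<n. of_bool (a = i \<and> c = j) + of_bool (a = j \<and> c = i))"
    using assms by (intro dom_deriv_sum dom_deriv_sign_mat ij) auto
  moreover have "(\<Sum>c<n. of_bool (a = i \<and> c = j) + of_bool (a = j \<and> c = i)) = (of_bool (a = i) + of_bool (a = j) :: real)"
    using ij sum_of_bool_mult(2)[of _ n "\<lambda>_. of_bool (a = i)"] sum_of_bool_mult(2)[of _ n "\<lambda>_. of_bool (a = j)"]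
    by (simp add: sum.distrib of_bool_conj)
  ultimately show ?thesis by (simp add: row_sum_def[abs_def])
qed

lemma dom_deriv_total_sum:
  "dom_deriv (all_edges n) {Suc i, Suc j} (total_sum n) (\<lambda>_. 2)"
proof -
  have "dom_deriv (all_edges n) {Suc i, Suc j} (\<lambda>E. \<Sum>a<n. row_sum n a E)
    (\<lambda>_. \<Sum>a<n. of_bool (a = i) + of_bool (a = j))"
    by (intro dom_deriv_sum dom_deriv_row_sum) auto
  moreover have "(\<Sum>a<n. of_bool (a = i) + of_bool (a = j)) = (2 :: real)"
    using ij sum_of_bool_mult(3)[of _ n "\<lambda>_. 1"] by (simp add: sum.distrib)
  ultimately show ?thesis by (simp add: total_sum_def[abs_def])
qed

lemma dom_deriv_row_square_sum:
  "dom_deriv (all_edges n) {Suc i, Suc j} (row_square_sum n) (\<lambda>E. 2 * (row_sum n i E + row_sum n j E))"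
proof -
  have "dom_deriv (all_edges n) {Suc i, Suc j} (\<lambda>E. \<Sum>a<n. row_sum n a E * row_sum n a E)
    (\<lambda>E. \<Sum>a<n. (of_bool (a = i) + of_bool (a = j)) * row_sum n a E
      + row_sum n a E * (of_bool (a = i) + of_bool (a = j)))"
    by (intro dom_deriv_sum dom_deriv_mult dom_deriv_row_sum edge_in_all_edges ij) auto
  moreover have "(\<Sum>a<n. (of_bool (a = i) + of_bool (a = j)) * row_sum n a E
      + row_sum n a E * (of_bool (a = i) + of_bool (a = j))) = 2 * (row_sum n i E + row_sum n j E)" for E
    using ij by (simp only: sum.distrib distrib_left distrib_right sum_of_bool_mult)
  ultimately show ?thesis by (simp only: row_square_sum_def[abs_def])
qed

end

lemma expct_total_sum_square_le: "expct n (\<lambda>E. (total_sum n E)\<^sup>2) \<le> 2 * (real n)\<^sup>2"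
proof -
  have "(\<lambda>E. (total_sum n E)\<^sup>2) = (\<lambda>E. \<Sum>i<n. \<Sum>j<n. sign_mat E i j * total_sum n E)"
    unfolding power2_eq_square
    by (subst total_sum_def) (simp only: row_sum_def sum_distrib_right)
  then have "expct n (\<lambda>E. (total_sum n E)\<^sup>2) = (\<Sum>i<n. \<Sum>j<n. expct n (\<lambda>E. sign_mat E i j * total_sum n E))"
    by (simp only: expect_sum)
  also have "\<dots> \<le> (\<Sum>i<n. \<Sum>j<n. expct n (\<lambda>_. 2))"
    by (intro sum_mono expct_sign_mat_mult_le dom_deriv_total_sum)
      (auto simp: expect_const finite_all_edges)
  also have "\<dots> = 2 * (real n)\<^sup>2"
    by (simp add: expect_const finite_all_edges power2_eq_square)
  finally show ?thesis .
qed

text \<open>Only one of the two row-sum factors is expanded: this exposes a single sign for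
  integration by parts.\<close>

lemma row_square_sum_expand:
  "row_square_sum n E * f = (\<Sum>i<n. \<Sum>j<n. sign_mat E i j * (row_sum n i E * f))"
proof -
  have "row_sum n i E * row_sum n i E * f = (\<Sum>j<n. sign_mat E i j * (row_sum n i E * f))" for i
    by (subst row_sum_def) (simp only: sum_distrib_right mult.assoc)
  then show ?thesis by (simp only: row_square_sum_def sum_distrib_right)
qed

lemma expct_row_square_sum_le: "expct n (row_square_sum n) \<le> (real n)\<^sup>2"
proof -
  have "row_square_sum n = (\<lambda>E. \<Sum>i<n. \<Sum>j<n. sign_mat E i j * row_sum n i E)"
    using row_square_sum_expand[of n _ 1] by (simp add: fun_eq_iff)
  then have "expct n (row_square_sum n) = (\<Sum>i<n. \<Sum>j<n. expct n (\<lambda>E. sign_mat E i j * row_sum n i E))"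
    by (simp only: expect_sum)
  also have "\<dots> \<le> (\<Sum>i<n. \<Sum>j<n. expct n (\<lambda>_. 1))"
  proof (intro sum_mono expct_sign_mat_mult_le)
    fix i j assume "i \<in> {..<n}" "j \<in> {..<n}" "i \<noteq> j"
    then show "dom_deriv (all_edges n) {Suc i, Suc j} (row_sum n i) (\<lambda>_. 1)"
      using dom_deriv_row_sum[of i n j i] by simp
  qed (auto simp: expect_const finite_all_edges)
  also have "\<dots> = (real n)\<^sup>2"
    by (simp add: expect_const finite_all_edges power2_eq_square)
  finally show ?thesis .
qed

text \<open>In the expanded squares the products of an entry with itself contribute exactly
  \<open>n (n - 1)\<close>, and the remaining products lie in the cone.\<close>

lemma expct_row_square_sum_ge: "(real n)\<^sup>2 - real n \<le> expct n (row_square_sum n)"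
proof -
  define R where "R E = (\<Sum>i<n. \<Sum>j<n. \<Sum>c\<in>{..<n} - {j}. sign_mat E i j * sign_mat E i c)" for E
  have R: "R \<in> pos_cone (all_edges n)"
    unfolding R_def[abs_def] by (intro cone_sum pos_cone.mult sign_mat_in_cone) auto
  have "row_square_sum n E = ((real n)\<^sup>2 - real n) + R E" for E
  proof -
    have sq: "(\<Sum>j<n. sign_mat E i j * sign_mat E i j) = real n - 1" if "i < n" for i
    proof -
      have "(\<Sum>j<n. sign_mat E i j * sign_mat E i j) = (\<Sum>j<n. 1 - of_bool (j = i))"
        by (intro sum.cong) (auto simp: sign_mat_def rad_mult_self)
      then show ?thesis
        using sum_of_bool_mult(3)[OF that, of "\<lambda>_. 1"] by (simp add: sum_subtractf)
    qed
    have "row_square_sum n E = (\<Sum>i<n. \<Sum>j<n. \<Sum>c<n. sign_mat E i j * sign_mat E i c)"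
      by (simp only: row_square_sum_def row_sum_def sum_product)
    also have "\<dots> = (\<Sum>i<n. \<Sum>j<n. sign_mat E i j * sign_mat E i j
        + (\<Sum>c\<in>{..<n} - {j}. sign_mat E i j * sign_mat E i c))"
      by (intro sum.cong refl sum.remove) auto
    also have "\<dots> = (\<Sum>i<n. real n - 1) + R E"
      by (simp add: sum.distrib R_def sq)
    finally show ?thesis by (simp add: power2_eq_square algebra_simps)
  qed
  then have "row_square_sum n = (\<lambda>E. ((real n)\<^sup>2 - real n) + R E)" by (simp add: fun_eq_iff)
  then have "expct n (row_square_sum n) = ((real n)\<^sup>2 - real n) + expct n R"
    by (simp only: expect_add expect_const[OF finite_all_edges])
  with expect_cone_nonneg[OF finite_all_edges R] show ?thesis by simp
qed

text \<open>With \<open>Z\<close> the row square sum, differentiating the row sum gives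
  \<open>n^2 Z\<close> in total, and differentiating \<open>Z\<close> gives \<open>2 n Z\<close>
  plus twice the squared total sum, whose mean is at most \<open>2 n^2\<close>.\<close>

lemma expct_row_square_sum_square_le:
  "expct n (\<lambda>E. (row_square_sum n E)\<^sup>2) \<le> ((real n)\<^sup>2 + 2 * real n) * expct n (row_square_sum n) + 4 * (real n)\<^sup>2"
proof -
  let ?Z = "row_square_sum n"
  let ?D = "\<lambda>i j E. ?Z E + row_sum n i E * (2 * (row_sum n i E + row_sum n j E))"
  have "(\<lambda>E. (?Z E)\<^sup>2) = (\<lambda>E. \<Sum>i<n. \<Sum>j<n. sign_mat E i j * (row_sum n i E * ?Z E))"
    unfolding power2_eq_square row_square_sum_expand ..
  then have "expct n (\<lambda>E. (?Z E)\<^sup>2) = (\<Sum>i<n. \<Sum>j<n. expct n (\<lambda>E. sign_mat E i j * (row_sum n i E * ?Z E)))"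
    by (simp only: expect_sum)
  also have "\<dots> \<le> (\<Sum>i<n. \<Sum>j<n. expct n (?D i j))"
  proof (intro sum_mono expct_sign_mat_mult_le)
    fix i j assume ij: "i \<in> {..<n}" "j \<in> {..<n}"
    show "0 \<le> expct n (?D i j)"
      using ij by (intro expect_cone_nonneg finite_all_edges pos_cone.add pos_cone.mult cone_cmult
          row_sum_in_cone row_square_sum_in_cone) auto
    assume ne: "i \<noteq> j"
    have "dom_deriv (all_edges n) {Suc i, Suc j} (\<lambda>E. row_sum n i E * ?Z E)
      (\<lambda>E. (of_bool (i = i) + of_bool (i = j)) * ?Z E + row_sum n i E * (2 * (row_sum n i E + row_sum n j E)))"
      using ij ne by (intro dom_deriv_mult dom_deriv_row_sum dom_deriv_row_square_sum edge_in_all_edges) auto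
    then show "dom_deriv (all_edges n) {Suc i, Suc j} (\<lambda>E. row_sum n i E * ?Z E) (?D i j)"
      using ne by simp
  qed auto
  also have "\<dots> = expct n (\<lambda>E. \<Sum>i<n. \<Sum>j<n. ?D i j E)"
    by (simp only: expect_sum)
  also have "(\<lambda>E. \<Sum>i<n. \<Sum>j<n. ?D i j E) =
    (\<lambda>E. ((real n)\<^sup>2 + 2 * real n) * ?Z E + 2 * (total_sum n E)\<^sup>2)"
  proof
    fix E
    have "(\<Sum>i<n. \<Sum>j<n. ?D i j E) = (\<Sum>i<n. \<Sum>j<n. ?Z E) + 2 * (\<Sum>i<n. \<Sum>j<n. row_sum n i E * row_sum n i E)
      + 2 * (\<Sum>i<n. \<Sum>j<n. row_sum n i E * row_sum n j E)"
      by (simp add: sum.distrib sum_distrib_left algebra_simps)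
    also have "(\<Sum>i<n. \<Sum>j<n. row_sum n i E * row_sum n j E) = (total_sum n E)\<^sup>2"
      by (simp add: total_sum_def power2_eq_square sum_product)
    also have "(\<Sum>i<n. \<Sum>j<n. row_sum n i E * row_sum n i E) = real n * ?Z E"
      by (simp add: row_square_sum_def sum_distrib_left)
    also have "(\<Sum>i<n. \<Sum>j<n. ?Z E) = (real n)\<^sup>2 * ?Z E"
      by (simp add: power2_eq_square)
    finally show "(\<Sum>i<n. \<Sum>j<n. ?D i j E) = ((real n)\<^sup>2 + 2 * real n) * ?Z E + 2 * (total_sum n E)\<^sup>2"
      by (simp add: algebra_simps)
  qed
  finally show ?thesis
    unfolding expect_add expect_cmult using expct_total_sum_square_le[of n] by linarith
qed

text \<open>After expansion the mean enters once with factor \<open>- n^2\<close> and once with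
  \<open>2 n\<close>, so it is bounded from below and from above respectively. The terms of order
  \<open>n^4\<close> then cancel.\<close>

lemma expct_row_square_sum_deviation_le:
  assumes "0 < n"
  shows "expct n (\<lambda>E. (row_square_sum n E - (real n)\<^sup>2)\<^sup>2) \<le> 7 * real n ^ 3"
proof -
  let ?m = "expct n (row_square_sum n)"
  have "(\<lambda>E. (row_square_sum n E - (real n)\<^sup>2)\<^sup>2) =
    (\<lambda>E. (row_square_sum n E)\<^sup>2 + (- 2 * (real n)\<^sup>2) * row_square_sum n E + real n ^ 4)"
    by (simp add: fun_eq_iff power2_diff)
  then have "expct n (\<lambda>E. (row_square_sum n E - (real n)\<^sup>2)\<^sup>2) =
    expct n (\<lambda>E. (row_square_sum n E)\<^sup>2) - 2 * (real n)\<^sup>2 * ?m + real n ^ 4"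
    by (simp only: expect_add expect_cmult expect_const[OF finite_all_edges])
  also have "\<dots> \<le> real n ^ 4 - (real n)\<^sup>2 * ?m + 2 * real n * ?m + 4 * (real n)\<^sup>2"
    using expct_row_square_sum_square_le[of n] by (simp add: algebra_simps)
  also have "\<dots> \<le> real n ^ 4 - (real n)\<^sup>2 * ((real n)\<^sup>2 - real n) + 2 * real n * (real n)\<^sup>2 + 4 * (real n)\<^sup>2"
    using mult_left_mono[OF expct_row_square_sum_ge[of n], of "(real n)\<^sup>2"]
      mult_left_mono[OF expct_row_square_sum_le[of n], of "2 * real n"] by simp
  also have "\<dots> = 3 * real n ^ 3 + 4 * (real n)\<^sup>2"
    by (simp add: power2_eq_square power3_eq_cube power4_eq_xxxx algebra_simps)
  also have "\<dots> \<le> 7 * real n ^ 3"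
    using power_increasing[of 2 3 "real n"] assms by simp
  finally show ?thesis .
qed

lemma markov_graphs:
  assumes "\<And>E. 0 \<le> f E" "0 < t"
  shows "real (card {E \<in> graphs_on n. t < f E}) / real (card (graphs_on n)) \<le> expct n f / t"
proof -
  have fin: "finite (graphs_on n)" by (simp add: graphs_on_eq finite_all_edges)
  have "real (card {E \<in> graphs_on n. t < f E}) * t = (\<Sum>E\<in>{E \<in> graphs_on n. t < f E}. t)"
    by simp
  also have "\<dots> \<le> (\<Sum>E\<in>{E \<in> graphs_on n. t < f E}. f E)"
    by (intro sum_mono) auto
  also have "\<dots> \<le> (\<Sum>E\<in>graphs_on n. f E)"
    using fin assms by (intro sum_mono2) auto
  finally have "real (card {E \<in> graphs_on n. t < f E}) * t / real (card (graphs_on n)) \<le> expct n f"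
    unfolding expect_def graphs_on_eq by (intro divide_right_mono) auto
  then show ?thesis using assms(2) by (simp add: field_simps)
qed

section \<open>Symmetric matrices\<close>

text \<open>The squared lengths \<open>N k\<close> of \<open>M^k x\<close> are log-convex in
  \<open>k\<close>, so \<open>(N 1 / N 0)^p\<close> is at most \<open>N p / N 0\<close>, hence at
  most the squared Frobenius norm of \<open>M^p\<close>, which is the trace of
  \<open>M^(2p)\<close>. Taking \<open>p\<close>-th roots replaces any diagonalisation.\<close>

lemma sum_square_mat_le_of_mtrace:
  fixes M :: "nat \<Rightarrow> nat \<Rightarrow> real"
  assumes sym: "\<And>i j. M i j = M j i" and p: "0 < p" and B: "0 \<le> B" "mtrace n M (2 * p) \<le> B ^ p"
  shows "(\<Sum>i<n. (\<Sum>j<n. M i j * x j)\<^sup>2) \<le> B * (\<Sum>i<n. (x i)\<^sup>2)"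
proof -
  define y where "y k i = (\<Sum>j<n. mpow n M k i j * x j)" for k i
  define N where "N k = (\<Sum>i<n. (y k i)\<^sup>2)" for k
  have ySuc: "y (Suc k) i = (\<Sum>c<n. M i c * y k c)" for k i
    unfolding y_def sum_distrib_left mpow.simps sum_distrib_right
    by (subst sum.swap) (simp add: mult.assoc)
  have y0: "y 0 i = x i" if "i < n" for i
    using that by (simp add: y_def sum_of_bool_mult)
  have N0: "N 0 = (\<Sum>i<n. (x i)\<^sup>2)" and N1: "N 1 = (\<Sum>i<n. (\<Sum>j<n. M i j * x j)\<^sup>2)"
    by (auto simp: N_def ySuc y0 intro!: sum.cong)
  have nonneg: "0 \<le> N k" for k by (simp add: N_def sum_nonneg)
  \<comment> \<open>Symmetry moves one factor \<open>M\<close> to the other side of the inner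
    product; the rest is Cauchy-Schwarz.\<close>
  have conv: "(N (Suc k))\<^sup>2 \<le> N k * N (Suc (Suc k))" for k
  proof -
    have "N (Suc k) = (\<Sum>i<n. y (Suc k) i * (\<Sum>c<n. M i c * y k c))"
      by (simp add: N_def power2_eq_square ySuc)
    also have "\<dots> = (\<Sum>c<n. y k c * (\<Sum>i<n. M c i * y (Suc k) i))"
      unfolding sum_distrib_left by (subst sum.swap) (intro sum.cong refl, simp add: sym mult_ac)
    also have "\<dots> = (\<Sum>c<n. y k c * y (Suc (Suc k)) c)" by (simp add: ySuc[of "Suc k"])
    finally show ?thesis
      unfolding N_def by (metis Cauchy_Schwarz_ineq_sum)
  qed
  have ratio: "N 1 * N k \<le> N 0 * N (Suc k)" for k
  proof (induction k)
    case 0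
    then show ?case by simp
  next
    case (Suc k)
    show ?case
    proof (cases "N k = 0")
      case True
      then have "N (Suc k) = 0" using conv[of k] by simp
      then show ?thesis using nonneg by simp
    next
      case False
      then have pos: "0 < N k" using nonneg[of k] by simp
      have "N k * (N 1 * N (Suc k)) = (N 1 * N k) * N (Suc k)" by simp
      also have "\<dots> \<le> (N 0 * N (Suc k)) * N (Suc k)"
        using Suc nonneg by (intro mult_right_mono)
      also have "\<dots> = N 0 * (N (Suc k))\<^sup>2" by (simp add: power2_eq_square)
      also have "\<dots> \<le> N 0 * (N k * N (Suc (Suc k)))"
        using conv nonneg by (intro mult_left_mono)
      finally have "N k * (N 1 * N (Suc k)) \<le> N k * (N 0 * N (Suc (Suc k)))" by (simp add: mult_ac)
      then show ?thesis using pos by simp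
    qed
  qed
  have pow: "N 1 ^ k * N 0 \<le> N k * N 0 ^ k" for k
  proof (induction k)
    case (Suc k)
    have "N 1 ^ Suc k * N 0 = N 1 * (N 1 ^ k * N 0)" by simp
    also have "\<dots> \<le> N 1 * (N k * N 0 ^ k)" using Suc nonneg by (intro mult_left_mono)
    also have "\<dots> = (N 1 * N k) * N 0 ^ k" by simp
    also have "\<dots> \<le> (N 0 * N (Suc k)) * N 0 ^ k"
      using ratio nonneg by (intro mult_right_mono) auto
    finally show ?case by (simp add: mult_ac)
  qed simp
  have "N p \<le> (\<Sum>i<n. (\<Sum>j<n. (mpow n M p i j)\<^sup>2) * N 0)"
    unfolding N_def[of p] y_def N0 by (intro sum_mono Cauchy_Schwarz_ineq_sum)
  also have "\<dots> = mtrace n M (2 * p) * N 0"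
    by (simp add: mtrace_double[OF sym] sum_distrib_right)
  also have "\<dots> \<le> B ^ p * N 0" using B nonneg by (intro mult_right_mono)
  finally have Np: "N p \<le> B ^ p * N 0" .
  show ?thesis
  proof (cases "N 0 = 0")
    case True
    then have "\<forall>i<n. x i = 0" unfolding N0 by (simp add: sum_nonneg_eq_0_iff)
    then show ?thesis by simp
  next
    case False
    then have pos: "0 < N 0" using nonneg[of 0] by simp
    have "N 1 ^ p * N 0 \<le> (B ^ p * N 0) * N 0 ^ p"
      using pow[of p] mult_right_mono[OF Np, of "N 0 ^ p"] nonneg[of 0] by simp
    then have "N 1 ^ p \<le> (B * N 0) ^ p" using pos by (simp add: power_mult_distrib mult_ac)
    then have "N 1 \<le> B * N 0"
      using B nonneg p by (simp add: power_mono_iff)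
    then show ?thesis unfolding N0 N1 .
  qed
qed

section \<open>The maximal eigenvalue of a real symmetric matrix\<close>

lemma linear_coeff_zero_of_quadratic_nonneg:
  fixes b c :: real
  assumes "\<And>t. 0 \<le> b * t + c * t\<^sup>2"
  shows "b = 0"
proof (rule ccontr)
  assume "b \<noteq> 0"
  define d where "d = \<bar>c\<bar> + 1"
  have d: "0 < d" "c < d" by (auto simp: d_def)
  have "b * (- b / d) + c * (- b / d)\<^sup>2 = b\<^sup>2 * (c - d) / d\<^sup>2"
    using d by (simp add: field_simps power2_eq_square)
  also have "\<dots> < 0"
    using d \<open>b \<noteq> 0\<close> by (intro divide_neg_pos mult_pos_neg) auto
  finally show False using assms[of "- b / d"] by linarith
qed

text \<open>A maximiser \<open>v\<close> of the quadratic form on the unit sphere. The function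
  \<open>l * Q - F\<close> is nonnegative and vanishes at \<open>v\<close>; along the residual
  \<open>r = l v - M v\<close> its linear coefficient is twice the squared length of
  \<open>r\<close>, so \<open>r\<close> is zero.\<close>

lemma exists_maximal_eigenvalue:
  fixes M :: "nat \<Rightarrow> nat \<Rightarrow> real"
  assumes sym: "\<And>i j. M i j = M j i" and n: "0 < n"
  obtains l v where "\<exists>i<n. v i \<noteq> 0" "\<And>i. i < n \<Longrightarrow> (\<Sum>j<n. M i j * v j) = l * v i"
    "\<And>x. (\<Sum>i<n. \<Sum>j<n. x i * M i j * x j) \<le> l * (\<Sum>i<n. (x i)\<^sup>2)"
proof -
  define F where "F x = (\<Sum>i<n. \<Sum>j<n. x i * M i j * x j)" for x
  define Q where "Q x = (\<Sum>i<n. (x i)\<^sup>2)" for x :: "nat \<Rightarrow> real"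
  \<comment> \<open>Coordinates from \<open>n\<close> on are pinned to 0, so the box is a product of
    compact sets and contains the unit sphere of the first \<open>n\<close> coordinates.\<close>
  define C where "C = PiE UNIV (\<lambda>i. if i < n then {-1..1} else {0::real})"
  have "compactin (product_topology (\<lambda>i. euclidean) UNIV) C"
    unfolding C_def by (subst compactin_PiE) auto
  then have cC: "compact C" by (simp add: euclidean_product_topology)
  have contQ: "continuous_on UNIV Q" and contF: "continuous_on UNIV F"
    unfolding Q_def[abs_def] F_def[abs_def] by (intro continuous_intros continuous_on_product_coordinates)+
  have "closed (Q -` {1})"
    using contQ by (intro continuous_closed_vimage) (auto simp: continuous_on_eq_continuous_at)
  then have cK: "compact (C \<inter> Q -` {1})" by (rule compact_Int_closed[OF cC])
  have scale: "(\<lambda>i. if i < n then x i / sqrt (Q x) else 0) \<in> C \<inter> Q -` {1} \<and>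
      F (\<lambda>i. if i < n then x i / sqrt (Q x) else 0) = F x / Q x" if "0 < Q x" for x
  proof -
    let ?y = "\<lambda>i. if i < n then x i / sqrt (Q x) else 0"
    have le: "\<bar>x i\<bar> \<le> sqrt (Q x)" if "i < n" for i
    proof -
      have "(x i)\<^sup>2 \<le> Q x" unfolding Q_def using that by (intro member_le_sum) auto
      then show ?thesis using real_le_rsqrt[of "\<bar>x i\<bar>"] by simp
    qed
    have "?y i \<in> (if i < n then {-1..1} else {0})" for i
      using that le[of i] by (auto simp: abs_le_iff field_simps)
    then have "?y \<in> C" by (auto simp: C_def)
    moreover have "Q ?y = Q x / Q x"
      unfolding Q_def[of ?y] using that
      by (simp add: power_divide less_imp_le flip: sum_divide_distrib) (simp add: Q_def)
    moreover have "F ?y = (\<Sum>i<n. \<Sum>j<n. x i * M i j * x j / Q x)"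
      unfolding F_def using that by (intro sum.cong refl) (auto simp: field_simps)
    then have "F ?y = F x / Q x" by (simp add: F_def sum_divide_distrib)
    ultimately show ?thesis using that by auto
  qed
  have "0 < Q (\<lambda>i. 1)" using n by (simp add: Q_def)
  from scale[OF this] have "C \<inter> Q -` {1} \<noteq> {}" by blast
  then obtain v where v: "v \<in> C \<inter> Q -` {1}" and max: "\<And>x. x \<in> C \<inter> Q -` {1} \<Longrightarrow> F x \<le> F v"
    using continuous_attains_sup[OF cK _ continuous_on_subset[OF contF subset_UNIV]] by blast
  define l where "l = F v"
  have Qv: "Q v = 1" using v by simp
  have bound: "F x \<le> l * Q x" for x
  proof (cases "Q x = 0")
    case True
    then have "\<forall>i<n. x i = 0" unfolding Q_def by (simp add: sum_nonneg_eq_0_iff)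
    then show ?thesis using True by (simp add: F_def)
  next
    case False
    then have pos: "0 < Q x" using sum_nonneg[of "{..<n}" "\<lambda>i. (x i)\<^sup>2"] by (simp add: Q_def order_less_le)
    from scale[OF pos] max have "F x / Q x \<le> l" unfolding l_def by metis
    then show ?thesis using pos by (simp add: field_simps)
  qed
  define r where "r i = l * v i - (\<Sum>j<n. M i j * v j)" for i
  have expF: "F (\<lambda>i. v i + t * r i) = F v + 2 * t * (\<Sum>i<n. r i * (\<Sum>j<n. M i j * v j)) + t\<^sup>2 * F r" for t
  proof -
    have swap: "(\<Sum>i<n. \<Sum>j<n. v i * M i j * r j) = (\<Sum>i<n. \<Sum>j<n. r i * M i j * v j)"
      by (subst sum.swap) (intro sum.cong refl, simp add: sym mult_ac)
    have "F (\<lambda>i. v i + t * r i) = F v + t * (\<Sum>i<n. \<Sum>j<n. v i * M i j * r j)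
      + t * (\<Sum>i<n. \<Sum>j<n. r i * M i j * v j) + t\<^sup>2 * F r"
      unfolding F_def sum_distrib_left sum.distrib[symmetric]
      by (intro sum.cong refl) (simp add: algebra_simps power2_eq_square)
    then show ?thesis unfolding swap by (simp add: sum_distrib_left mult.assoc)
  qed
  have expQ: "Q (\<lambda>i. v i + t * r i) = Q v + 2 * t * (\<Sum>i<n. r i * v i) + t\<^sup>2 * Q r" for t
    unfolding Q_def sum_distrib_left sum.distrib[symmetric]
    by (intro sum.cong refl) (simp add: algebra_simps power2_eq_square)
  have Qr: "Q r = l * (\<Sum>i<n. r i * v i) - (\<Sum>i<n. r i * (\<Sum>j<n. M i j * v j))"
    unfolding Q_def sum_distrib_left[of l] sum_subtractf[symmetric]
    by (intro sum.cong refl) (simp add: r_def algebra_simps power2_eq_square)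
  have "0 \<le> (2 * Q r) * t + (l * Q r - F r) * t\<^sup>2" for t
    using bound[of "\<lambda>i. v i + t * r i"] unfolding expF expQ
    by (simp add: Qv Qr l_def[symmetric] algebra_simps)
  from linear_coeff_zero_of_quadratic_nonneg[OF this] have "\<forall>i<n. r i = 0"
    by (simp add: Q_def sum_nonneg_eq_0_iff)
  then have eig: "(\<Sum>j<n. M i j * v j) = l * v i" if "i < n" for i
    using that by (simp add: r_def)
  have "\<exists>i<n. v i \<noteq> 0"
  proof (rule ccontr)
    assume "\<not> ?thesis"
    then have "Q v = 0" by (simp add: Q_def)
    with Qv show False by simp
  qed
  with eig bound that show ?thesis unfolding F_def Q_def by blast
qed

section \<open>The skewed adjacency matrix\<close>

definition skew_mat :: "real \<Rightarrow> nat \<Rightarrow> nat set set \<Rightarrow> nat \<Rightarrow> nat \<Rightarrow> real" where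
  "skew_mat a n E i j = sign_mat E i j / 2 + a / sqrt (real n)"

lemma skewed_adjacency_carrier: "skewed_adjacency a n E \<in> carrier_mat n n"
  by (simp add: skewed_adjacency_def signed_adjacency_def all_ones_def)

lemma skewed_adjacency_index:
  "i < n \<Longrightarrow> j < n \<Longrightarrow> skewed_adjacency a n E $$ (i, j) = skew_mat a n E i j"
  by (simp add: skewed_adjacency_def signed_adjacency_def all_ones_def skew_mat_def sign_mat_def rad_def)

text \<open>Passes from vectors of the matrix library to functions on indices, where the variational
  argument lives.\<close>

lemma eigenvalue_iff_fun:
  assumes A: "A \<in> carrier_mat n n" and M: "\<And>i j. i < n \<Longrightarrow> j < n \<Longrightarrow> A $$ (i, j) = M i j"
  shows "eigenvalue A l \<longleftrightarrow> (\<exists>v. (\<exists>i<n. v i \<noteq> 0) \<and> (\<forall>i<n. (\<Sum>j<n. M i j * v j) = l * v i))"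
proof
  assume "eigenvalue A l"
  then obtain v where v: "v \<in> carrier_vec n" "v \<noteq> 0\<^sub>v n" "A *\<^sub>v v = l \<cdot>\<^sub>v v"
    using A by (auto simp: eigenvalue_def eigenvector_def)
  from v(1,2) have "\<exists>i<n. vec_index v i \<noteq> 0" by (metis carrier_vecD eq_vecI index_zero_vec)
  moreover have "(\<Sum>j<n. M i j * vec_index v j) = l * vec_index v i" if "i < n" for i
  proof -
    have "vec_index (A *\<^sub>v v) i = (\<Sum>j<n. M i j * vec_index v j)"
      using that A v(1) by (simp add: scalar_prod_def M atLeast0LessThan)
    then show ?thesis using v that by simp
  qed
  ultimately show "\<exists>v. (\<exists>i<n. v i \<noteq> 0) \<and> (\<forall>i<n. (\<Sum>j<n. M i j * v j) = l * v i)"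
    by (intro exI[of _ "\<lambda>i. vec_index v i"]) auto
next
  assume "\<exists>v. (\<exists>i<n. v i \<noteq> 0) \<and> (\<forall>i<n. (\<Sum>j<n. M i j * v j) = l * v i)"
  then obtain v where v: "\<exists>i<n. v i \<noteq> 0" "\<And>i. i < n \<Longrightarrow> (\<Sum>j<n. M i j * v j) = l * v i"
    by blast
  have "vec n v \<noteq> 0\<^sub>v n" using v(1) by (metis index_vec index_zero_vec(1))
  moreover have "A *\<^sub>v vec n v = l \<cdot>\<^sub>v vec n v"
    using A v(2) by (intro eq_vecI) (auto simp: scalar_prod_def M atLeast0LessThan)
  ultimately show "eigenvalue A l"
    using A by (auto simp: eigenvalue_def eigenvector_def intro!: exI[of _ "vec n v"])
qed

text \<open>Every eigenvalue is the Rayleigh quotient of its eigenvector, so the variational maximum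
  is the \<open>Max\<close> of the finite spectrum.\<close>

lemma largest_eigenvalue_sym:
  assumes A: "A \<in> carrier_mat n n" and M: "\<And>i j. i < n \<Longrightarrow> j < n \<Longrightarrow> A $$ (i, j) = M i j"
    and sym: "\<And>i j. M i j = M j i" and n: "0 < n"
  obtains v where "\<exists>i<n. v i \<noteq> 0"
    "\<And>i. i < n \<Longrightarrow> (\<Sum>j<n. M i j * v j) = largest_eigenvalue A * v i"
    "\<And>x. (\<Sum>i<n. \<Sum>j<n. x i * M i j * x j) \<le> largest_eigenvalue A * (\<Sum>i<n. (x i)\<^sup>2)"
proof -
  obtain l v where v: "\<exists>i<n. v i \<noteq> 0" "\<And>i. i < n \<Longrightarrow> (\<Sum>j<n. M i j * v j) = l * v i"
    "\<And>x. (\<Sum>i<n. \<Sum>j<n. x i * M i j * x j) \<le> l * (\<Sum>i<n. (x i)\<^sup>2)"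
    by (rule exists_maximal_eigenvalue[where M = M and n = n, OF sym n]) blast
  note iff = eigenvalue_iff_fun[OF A M]
  have "largest_eigenvalue A = l"
    unfolding largest_eigenvalue_def
  proof (rule Max_eqI)
    show "finite (spectrum A)" by (rule card_finite_spectrum(1)[OF A])
    show "l \<in> spectrum A" using v by (auto simp: spectrum_def iff)
    fix l' assume "l' \<in> spectrum A"
    then obtain w where w: "\<exists>i<n. w i \<noteq> 0" "\<And>i. i < n \<Longrightarrow> (\<Sum>j<n. M i j * w j) = l' * w i"
      by (auto simp: spectrum_def iff)
    have "(\<Sum>i<n. \<Sum>j<n. w i * M i j * w j) = (\<Sum>i<n. w i * (\<Sum>j<n. M i j * w j))"
      by (simp add: sum_distrib_left mult.assoc)
    also have "\<dots> = (\<Sum>i<n. w i * (l' * w i))" by (simp add: w(2))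
    also have "\<dots> = l' * (\<Sum>i<n. (w i)\<^sup>2)"
      by (simp add: sum_distrib_left power2_eq_square mult_ac)
    finally have le: "l' * (\<Sum>i<n. (w i)\<^sup>2) \<le> l * (\<Sum>i<n. (w i)\<^sup>2)"
      using v(3)[of w] by simp
    have "(\<Sum>i<n. (w i)\<^sup>2) \<noteq> 0"
      using w(1) by (auto simp: sum_nonneg_eq_0_iff)
    then have "0 < (\<Sum>i<n. (w i)\<^sup>2)"
      using sum_nonneg[of "{..<n}" "\<lambda>i. (w i)\<^sup>2"] by simp
    with le show "l' \<le> l" by simp
  qed
  with v that show ?thesis by blast
qed

lemma skew_mat_sym: "skew_mat a n E i j = skew_mat a n E j i"
  by (simp add: skew_mat_def sign_mat_sym[of E i j])

lemma largest_eigenvalue_skewed: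
  assumes "0 < n"
  obtains v where "\<exists>i<n. v i \<noteq> 0"
    "\<And>i. i < n \<Longrightarrow> (\<Sum>j<n. skew_mat a n E i j * v j) =
      largest_eigenvalue (skewed_adjacency a n E) * v i"
    "\<And>x. (\<Sum>i<n. \<Sum>j<n. x i * skew_mat a n E i j * x j) \<le>
      largest_eigenvalue (skewed_adjacency a n E) * (\<Sum>i<n. (x i)\<^sup>2)"
  by (rule largest_eigenvalue_sym[where A = "skewed_adjacency a n E" and n = n and M = "skew_mat a n E",
      OF skewed_adjacency_carrier skewed_adjacency_index skew_mat_sym assms]) blast+

section \<open>The quadratic form at an indicator vector, and soundness\<close>

lemma card_ordered_edges:
  assumes "finite W" and F: "\<And>e. e \<in> F \<Longrightarrow> e \<subseteq> W \<and> card e = 2"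
  shows "card {(u, w). u \<in> W \<and> w \<in> W \<and> u \<noteq> w \<and> {u, w} \<in> F} = 2 * card F"
proof -
  let ?P = "{(u, w). u \<in> W \<and> w \<in> W \<and> u \<noteq> w \<and> {u, w} \<in> F}"
  let ?g = "\<lambda>(u, w). {u, w}"
  have finP: "finite ?P" by (rule finite_subset[of _ "W \<times> W"]) (use assms in auto)
  have finF: "finite F" by (rule finite_subset[of _ "Pow W"]) (use assms in auto)
  have img: "?g ` ?P \<subseteq> F" by auto
  have "card ?P = (\<Sum>e\<in>F. card {p \<in> ?P. ?g p = e})"
    using sum.group[OF finP finF img, of "\<lambda>_. 1 :: nat"] by simp
  also have "\<dots> = (\<Sum>e\<in>F. 2)"
  proof (rule sum.cong[OF refl])
    fix e assume e: "e \<in> F"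
    then obtain u w where uw: "e = {u, w}" "u \<noteq> w" using F by (meson card_2_iff)
    then have "{p \<in> ?P. ?g p = e} = {(u, w), (w, u)}"
      using e F[OF e] by (auto simp: doubleton_eq_iff insert_commute)
    then show "card {p \<in> ?P. ?g p = e} = 2" using uw by simp
  qed
  finally show ?thesis by simp
qed

text \<open>Off the diagonal a sign is twice the edge indicator minus 1, and each edge gives two
  ordered pairs. The signs over \<open>W\<close> thus add up to four times the edge count minus
  \<open>k (k - 1)\<close>, and half of this enters the form.\<close>

lemma skew_mat_indicator:
  assumes E: "E \<in> graphs_on n" and W: "W \<subseteq> {1..n}"
  defines "x \<equiv> \<lambda>i. of_bool (Suc i \<in> W)" and "k \<equiv> real (card W)"
  shows "(\<Sum>i<n. \<Sum>j<n. x i * skew_mat a n E i j * x j) =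
      2 * real (card (induced_edges E W)) - k * (k - 1) / 2 + k * (k * a / sqrt (real n))"
    and "(\<Sum>i<n. (x i)\<^sup>2) = k"
proof -
  have finW: "finite W" using W finite_subset by blast
  have reindex: "(\<Sum>i<n. x i * f (Suc i)) = (\<Sum>u\<in>W. f u)" for f :: "nat \<Rightarrow> real"
  proof -
    have "(\<Sum>i<n. x i * f (Suc i)) = (\<Sum>u=1..n. of_bool (u \<in> W) * f u)"
      unfolding x_def by (rule sum.reindex_bij_witness[of _ "\<lambda>u. u - 1" Suc]) auto
    also have "\<dots> = (\<Sum>u\<in>W. f u)"
      using W by (intro sum.mono_neutral_cong_right) auto
    finally show ?thesis .
  qed
  have "(\<Sum>i<n. (x i)\<^sup>2) = (\<Sum>i<n. x i * 1)"
    by (intro sum.cong) (auto simp: x_def)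
  then show "(\<Sum>i<n. (x i)\<^sup>2) = k"
    using reindex[of "\<lambda>_. 1"] by (simp only: k_def) simp
  define s where "s u w = (if u = w then 0 else rad {u, w} E)" for u w
  have sm: "sign_mat E i j = s (Suc i) (Suc j)" for i j by (simp add: s_def sign_mat_def)
  have "(\<Sum>i<n. \<Sum>j<n. x i * skew_mat a n E i j * x j) =
      (\<Sum>i<n. x i * (\<Sum>j<n. x j * (s (Suc i) (Suc j) / 2 + a / sqrt (real n))))"
    by (simp add: skew_mat_def sm sum_distrib_left mult_ac)
  also have "\<dots> = (\<Sum>i<n. x i * (\<Sum>w\<in>W. s (Suc i) w / 2 + a / sqrt (real n)))"
    by (simp only: reindex[where f = "\<lambda>w. s (Suc i) w / 2 + a / sqrt (real n)" for i])
  also have "\<dots> = (\<Sum>u\<in>W. \<Sum>w\<in>W. s u w / 2 + a / sqrt (real n))"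
    by (rule reindex[where f = "\<lambda>u. \<Sum>w\<in>W. s u w / 2 + a / sqrt (real n)"])
  also have "\<dots> = (\<Sum>u\<in>W. \<Sum>w\<in>W. s u w) / 2 + k * (k * a / sqrt (real n))"
    by (simp add: sum.distrib k_def sum_divide_distrib)
  also have "(\<Sum>u\<in>W. \<Sum>w\<in>W. s u w) = 4 * real (card (induced_edges E W)) - k * (k - 1)"
  proof -
    have "s u w = 2 * of_bool (u \<noteq> w \<and> {u, w} \<in> induced_edges E W) - (1 - of_bool (u = w))"
      if "u \<in> W" "w \<in> W" for u w
      using that by (auto simp: s_def rad_def induced_edges_def)
    then have "(\<Sum>u\<in>W. \<Sum>w\<in>W. s u w) =
      (\<Sum>u\<in>W. \<Sum>w\<in>W. 2 * of_bool (u \<noteq> w \<and> {u, w} \<in> induced_edges E W) - (1 - of_bool (u = w)))"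
      by (intro sum.cong) auto
    also have "\<dots> = 2 * (\<Sum>u\<in>W. \<Sum>w\<in>W. of_bool (u \<noteq> w \<and> {u, w} \<in> induced_edges E W))
      - (k * k - (\<Sum>u\<in>W. \<Sum>w\<in>W. of_bool (u = w)))"
      by (simp add: sum_subtractf sum_distrib_left k_def)
    also have "(\<Sum>u\<in>W. \<Sum>w\<in>W. of_bool (u = w)) = k"
      using finW by (simp add: of_bool_def sum.delta k_def)
    also have "(\<Sum>u\<in>W. \<Sum>w\<in>W. of_bool (u \<noteq> w \<and> {u, w} \<in> induced_edges E W)) =
      real (card {(u, w). u \<in> W \<and> w \<in> W \<and> u \<noteq> w \<and> {u, w} \<in> induced_edges E W})"
    proof -
      have "(\<Sum>u\<in>W. \<Sum>w\<in>W. of_bool (u \<noteq> w \<and> {u, w} \<in> induced_edges E W)) =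
        (\<Sum>p\<in>W \<times> W. of_bool (p \<in> {(u, w). u \<noteq> w \<and> {u, w} \<in> induced_edges E W}) :: real)"
        by (simp add: sum.cartesian_product case_prod_beta)
      also have "\<dots> = real (card ((W \<times> W) \<inter> {(u, w). u \<noteq> w \<and> {u, w} \<in> induced_edges E W}))"
        using finW by (simp add: of_bool_def sum.If_cases)
      also have "(W \<times> W) \<inter> {(u, w). u \<noteq> w \<and> {u, w} \<in> induced_edges E W} =
        {(u, w). u \<in> W \<and> w \<in> W \<and> u \<noteq> w \<and> {u, w} \<in> induced_edges E W}" by auto
      finally show ?thesis .
    qed
    also have "card {(u, w). u \<in> W \<and> w \<in> W \<and> u \<noteq> w \<and> {u, w} \<in> induced_edges E W}
      = 2 * card (induced_edges E W)"
      using E by (intro card_ordered_edges finW) (auto simp: induced_edges_def graphs_on_def)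
    finally show ?thesis by (simp add: algebra_simps)
  qed
  finally show "(\<Sum>i<n. \<Sum>j<n. x i * skew_mat a n E i j * x j) =
      2 * real (card (induced_edges E W)) - k * (k - 1) / 2 + k * (k * a / sqrt (real n))"
    by (simp add: field_simps)
qed

lemma skewed_spectral_sound:
  assumes n: "0 < n" and k: "0 < k" and E: "E \<in> certified_graphs (skewed_spectral a) n k \<epsilon>"
  shows "\<not> has_subgraph_with_excess n E k \<epsilon>"
proof
  assume "has_subgraph_with_excess n E k \<epsilon>"
  then obtain W where W: "W \<subseteq> {1..n}" "card W = k"
    and e: "(1/2 + \<epsilon>) * (real k * (real k - 1) / 2) \<le> real (card (induced_edges E W))"
    by (auto simp: has_subgraph_with_excess_def has_excess_def has_density_def)
  let ?l = "largest_eigenvalue (skewed_adjacency a n E)"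
  let ?x = "\<lambda>i. of_bool (Suc i \<in> W) :: real"
  have G: "E \<in> graphs_on n" and less: "?l < \<epsilon> * (real k - 1) + real k * a / sqrt (real n)"
    using E by (auto simp: certified_graphs_def skewed_spectral_def)
  \<comment> \<open>Density \<open>1/2 + \<epsilon>\<close> makes twice the edge count at least
    \<open>(1/2 + \<epsilon>) k (k - 1)\<close>; subtracting \<open>k (k - 1) / 2\<close> leaves
    \<open>\<epsilon> k (k - 1)\<close>.\<close>
  have "real k * (\<epsilon> * (real k - 1) + real k * a / sqrt (real n)) \<le>
    2 * real (card (induced_edges E W)) - real k * (real k - 1) / 2 + real k * (real k * a / sqrt (real n))"
    using e by (simp add: field_simps)
  also have "\<dots> = (\<Sum>i<n. \<Sum>j<n. ?x i * skew_mat a n E i j * ?x j)"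
    using skew_mat_indicator(1)[OF G W(1)] W(2) by simp
  also have "\<dots> \<le> ?l * (\<Sum>i<n. (?x i)\<^sup>2)"
    by (rule largest_eigenvalue_skewed[OF n, where a = a and E = E])
  also have "\<dots> = real k * ?l"
    using skew_mat_indicator(2)[OF G W(1)] W(2) by simp
  finally show False using less k by simp
qed

text \<open>For \<open>v = c 1 + y\<close> the eigenvalue equation reads
  \<open>l v = c g + w\<close>, where \<open>g\<close> consists of the row sums of the skewed matrix
  and \<open>w\<close> is half of \<open>S y\<close>. Comparing squared lengths bounds
  \<open>l^2\<close>, with \<open>P\<close> controlling \<open>g\<close> and \<open>R\<close>
  controlling \<open>w\<close>.\<close>

lemma largest_eigenvalue_skewed_le:
  assumes n: "0 < n" and a: "0 \<le> a" and \<delta>: "0 < \<delta>"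
    and T: "total_sum n E \<le> \<delta> * real n * sqrt (real n)"
    and Z: "row_square_sum n E \<le> (1 + \<delta>) * (real n)\<^sup>2"
    and S: "\<And>x. (\<Sum>i<n. (\<Sum>j<n. sign_mat E i j * x j)\<^sup>2) \<le> 4 * R * real n * (\<Sum>i<n. (x i)\<^sup>2)"
    and R: "0 < R"
  shows "largest_eigenvalue (skewed_adjacency a n E)
    \<le> sqrt (real n) * sqrt ((1 + \<delta>) / 4 + a * \<delta> + a\<^sup>2 + R)"
proof -
  define l where "l = largest_eigenvalue (skewed_adjacency a n E)"
  define P where "P = (1 + \<delta>) / 4 + a * \<delta> + a\<^sup>2"
  have P: "0 < P" unfolding P_def using a \<delta> by (intro add_pos_nonneg) auto
  obtain v where v: "\<exists>i<n. v i \<noteq> 0" "\<And>i. i < n \<Longrightarrow> (\<Sum>j<n. skew_mat a n E i j * v j) = l * v i"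
    unfolding l_def by (rule largest_eigenvalue_skewed[OF n, where a = a and E = E]) blast
  define c where "c = (\<Sum>i<n. v i) / real n"
  define y where "y i = v i - c" for i
  define g where "g i = row_sum n i E / 2 + a * sqrt (real n)" for i
  define w where "w i = (\<Sum>j<n. sign_mat E i j * y j) / 2" for i
  define Y where "Y = (\<Sum>i<n. (y i)\<^sup>2)"
  have ysum: "(\<Sum>i<n. y i) = 0"
    using n by (simp add: y_def c_def sum_subtractf)
  have Qv: "(\<Sum>i<n. (v i)\<^sup>2) = c\<^sup>2 * real n + Y"
  proof -
    have "(\<Sum>i<n. (v i)\<^sup>2) = (\<Sum>i<n. (y i)\<^sup>2 + 2 * c * y i + c\<^sup>2)"
      by (intro sum.cong refl) (simp add: y_def power2_eq_square algebra_simps)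
    then show ?thesis by (simp add: sum.distrib Y_def ysum flip: sum_distrib_left)
  qed
  have Qpos: "0 < (\<Sum>i<n. (v i)\<^sup>2)"
  proof -
    have "(\<Sum>i<n. (v i)\<^sup>2) \<noteq> 0" using v(1) by (auto simp: sum_nonneg_eq_0_iff)
    then show ?thesis using sum_nonneg[of "{..<n}" "\<lambda>i. (v i)\<^sup>2"] by simp
  qed
  have eq: "l * v i = c * g i + w i" if "i < n" for i
  proof -
    have "l * v i = (\<Sum>j<n. (sign_mat E i j / 2 + a / sqrt (real n)) * (c + y j))"
      using v(2)[OF that] by (simp add: skew_mat_def y_def)
    also have "\<dots> = (\<Sum>j<n. c * (sign_mat E i j / 2) + c * (a / sqrt (real n))
        + (sign_mat E i j * y j) / 2 + a / sqrt (real n) * y j)"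
      by (intro sum.cong refl) (simp add: algebra_simps add_divide_distrib)
    also have "\<dots> = c * (row_sum n i E / 2) + c * (real n * (a / sqrt (real n))) + w i
        + a / sqrt (real n) * (\<Sum>j<n. y j)"
      by (simp add: sum.distrib row_sum_def w_def sum_divide_distrib sum_distrib_left)
    also have "real n * (a / sqrt (real n)) = a * sqrt (real n)"
      using n by (simp add: field_simps)
    finally show ?thesis by (simp add: ysum g_def algebra_simps)
  qed
  have G: "(\<Sum>i<n. (g i)\<^sup>2) \<le> (real n)\<^sup>2 * P"
  proof -
    have "(\<Sum>i<n. (g i)\<^sup>2) = (\<Sum>i<n. row_sum n i E * row_sum n i E / 4
        + a * sqrt (real n) * row_sum n i E + a\<^sup>2 * real n)"
      by (intro sum.cong refl) (simp add: g_def power2_sum power_mult_distrib power2_eq_square[of "row_sum n _ E / 2"])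
    also have "\<dots> = row_square_sum n E / 4 + a * sqrt (real n) * total_sum n E + a\<^sup>2 * (real n)\<^sup>2"
      by (simp add: sum.distrib row_square_sum_def total_sum_def power2_eq_square sum_divide_distrib
          sum_distrib_left)
    also have "\<dots> \<le> (1 + \<delta>) * (real n)\<^sup>2 / 4 + a * sqrt (real n) * (\<delta> * real n * sqrt (real n))
        + a\<^sup>2 * (real n)\<^sup>2"
      using Z T a by (intro add_mono mult_left_mono divide_right_mono) auto
    also have "a * sqrt (real n) * (\<delta> * real n * sqrt (real n)) = a * \<delta> * (real n)\<^sup>2"
      by (simp add: power2_eq_square)
    finally show ?thesis by (simp add: P_def algebra_simps)
  qed
  have W: "(\<Sum>i<n. (w i)\<^sup>2) \<le> R * real n * Y"
  proof -
    have "(\<Sum>i<n. (w i)\<^sup>2) = (\<Sum>i<n. (\<Sum>j<n. sign_mat E i j * y j)\<^sup>2) / 4"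
      by (simp add: w_def power_divide flip: sum_divide_distrib)
    then show ?thesis using S[of y] by (simp add: Y_def)
  qed
  \<comment> \<open>The weights are balanced so that both final coefficients agree:
    \<open>(1 + R / P) * P\<close> and \<open>(1 + P / R) * R\<close> are both \<open>P + R\<close>,
    and the squared length of \<open>v\<close> can be factored out.\<close>
  have young: "(c * g i + w i)\<^sup>2 \<le> (1 + R / P) * c\<^sup>2 * (g i)\<^sup>2 + (1 + P / R) * (w i)\<^sup>2" for i
  proof -
    have "0 \<le> (R * (c * g i) - P * w i)\<^sup>2 / (P * R)" using P R by simp
    also have "\<dots> = R / P * (c * g i)\<^sup>2 + P / R * (w i)\<^sup>2 - 2 * (c * g i) * w i"
      using P R by (simp add: field_simps power2_eq_square)
    finally show ?thesis by (simp add: power2_sum power_mult_distrib algebra_simps)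
  qed
  have "l\<^sup>2 * (\<Sum>i<n. (v i)\<^sup>2) = (\<Sum>i<n. (l * v i)\<^sup>2)"
    by (simp add: sum_distrib_left power_mult_distrib)
  also have "\<dots> = (\<Sum>i<n. (c * g i + w i)\<^sup>2)" by (simp add: eq)
  also have "\<dots> \<le> (\<Sum>i<n. (1 + R / P) * c\<^sup>2 * (g i)\<^sup>2 + (1 + P / R) * (w i)\<^sup>2)"
    by (intro sum_mono young)
  also have "\<dots> = (1 + R / P) * c\<^sup>2 * (\<Sum>i<n. (g i)\<^sup>2) + (1 + P / R) * (\<Sum>i<n. (w i)\<^sup>2)"
    by (simp add: sum.distrib sum_distrib_left)
  also have "\<dots> \<le> (1 + R / P) * c\<^sup>2 * ((real n)\<^sup>2 * P) + (1 + P / R) * (R * real n * Y)"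
    using G W P R by (intro add_mono mult_left_mono) auto
  also have "\<dots> = real n * (P + R) * (\<Sum>i<n. (v i)\<^sup>2)"
    unfolding Qv using P R by (simp add: field_simps power2_eq_square)
  finally have "l\<^sup>2 \<le> real n * (P + R)" using Qpos by simp
  then have "l \<le> sqrt (real n * (P + R))" by (rule real_le_rsqrt)
  then show ?thesis unfolding l_def P_def by (simp add: real_sqrt_mult)
qed

text \<open>The exponent 1/4 is a convenient choice: with \<open>\<nu> = 1 / sqrt n\<close> as
  below, growth faster than \<open>log n\<close> and slower than \<open>sqrt n\<close> is what the
  estimates ask for.\<close>

definition walk_length :: "nat \<Rightarrow> nat" where
  "walk_length n = nat \<lfloor>real n powr (1/4)\<rfloor>"

lemma walk_length_bounds:
  assumes "0 < n"
  shows "0 < walk_length n" "real (walk_length n) \<le> real n powr (1/4)"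
    "real n powr (1/4) - 1 \<le> real (walk_length n)"
proof -
  have "1 \<le> real n powr (1/4)" using assms by (intro ge_one_powr_ge_zero) auto
  then show "0 < walk_length n" "real (walk_length n) \<le> real n powr (1/4)"
    "real n powr (1/4) - 1 \<le> real (walk_length n)"
    unfolding walk_length_def by linarith+
qed

text \<open>The scale \<open>s = r sqrt n\<close> gives \<open>q = 1 / r^2 < 1/4\<close>, which
  leaves the room \<open>1 - 4 / r^2\<close> for \<open>L \<nu>\<close>, a quantity tending to 0.
  The factor 2 is the bound on the Catalan-like sum.\<close>

lemma expct_strace_le_eventually:
  fixes r :: real
  assumes r: "2 < r"
  shows "\<forall>\<^sub>F n in sequentially.
    expct n (strace n (2 * walk_length n)) \<le> 2 * real n * (r\<^sup>2 * real n) ^ walk_length n"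
proof -
  have r4: "4 < r\<^sup>2" using power_strict_mono[of 2 r 2] r by simp
  then have "0 < 1 - 4 / r\<^sup>2" by (simp add: divide_less_eq)
  moreover have "((\<lambda>n::nat. 2 * real n powr (1/4) * (1 / sqrt (real n))) \<longlongrightarrow> 0) sequentially"
    by real_asymp
  ultimately have "\<forall>\<^sub>F n in sequentially. 2 * real n powr (1/4) * (1 / sqrt (real n)) < 1 - 4 / r\<^sup>2"
    by (rule order_tendstoD(2)[rotated])
  moreover have "\<forall>\<^sub>F n in sequentially. real n powr (1/4) / real n + 2 * real n powr (1/4) / (real n * sqrt (real n))
    \<le> 1 / sqrt (real n)"
    by real_asymp
  moreover have "\<forall>\<^sub>F n::nat in sequentially. 0 < n" by (rule eventually_gt_at_top)
  ultimately show ?thesis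
  proof eventually_elim
    case (elim n)
    define p where "p = walk_length n"
    define s where "s = r * sqrt (real n)"
    define \<nu> where "\<nu> = 1 / sqrt (real n)"
    note p = walk_length_bounds[OF elim(3), folded p_def]
    have s: "0 < s" "s\<^sup>2 = r\<^sup>2 * real n" using elim(3) r by (simp_all add: s_def power_mult_distrib)
    have q: "real n / s\<^sup>2 = 1 / r\<^sup>2" using elim(3) by (simp add: s)
    have \<nu>: "0 < \<nu>" "\<nu> \<le> 1" using elim(3) by (simp_all add: \<nu>_def)
    have "real (2 * p) * \<nu> \<le> 2 * real n powr (1/4) * \<nu>"
      using p(2) \<nu>(1) by (intro mult_right_mono) auto
    then have sum_le: "real (2 * p) * \<nu> + 4 * (real n / s\<^sup>2) \<le> 1"
      using elim(1) unfolding q \<nu>_def by simp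
    have s4: "4 * real n \<le> s\<^sup>2" using r4 by (simp add: s mult_right_mono)
    have "2 * real (2 * p) / s\<^sup>2 \<le> 4 * real n powr (1/4) / (4 * real n)"
      using p(2) s4 elim(3) by (intro frac_le) auto
    moreover have "4 * real (2 * p) / (\<nu> * real n * s\<^sup>2) \<le> 8 * real n powr (1/4) / (\<nu> * real n * (4 * real n))"
      using p(2) s4 elim(3) \<nu>(1) by (intro frac_le mult_left_mono) auto
    moreover have "8 * real n powr (1/4) / (\<nu> * real n * (4 * real n)) = 2 * real n powr (1/4) / (real n * sqrt (real n))"
      using elim(3) by (simp add: \<nu>_def field_simps)
    ultimately have err_le: "2 * real (2 * p) / s\<^sup>2 + 4 * real (2 * p) / (\<nu> * real n * s\<^sup>2) \<le> \<nu>"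
      using elim(2) unfolding \<nu>_def by simp
    have "expct n (strace n (2 * p)) = expct n (straces n [2 * p])"
      by (simp add: straces_def[abs_def])
    also have "\<dots> \<le> real n * s ^ (2 * p) * catalan_like (real n / s\<^sup>2) \<nu> (2 * p)"
      using expct_straces_le[OF elim(3) s(1) \<nu> sum_le err_le, of "[2 * p]"] by simp
    also have "\<dots> \<le> real n * s ^ (2 * p) * 2"
    proof (intro mult_left_mono)
      have nn: "0 \<le> catalan_like (real n / s\<^sup>2) \<nu> k" for k
        using catalan_like_ge[of "real n / s\<^sup>2" \<nu> k] \<nu> by simp
      have "catalan_like (real n / s\<^sup>2) \<nu> (2 * p) \<le> (\<Sum>k\<le>2 * p. catalan_like (real n / s\<^sup>2) \<nu> k)"
        by (rule member_le_sum) (auto simp: nn)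
      also have "\<dots> \<le> 2"
        using \<nu> sum_le by (intro sum_catalan_like_le) auto
      finally show "catalan_like (real n / s\<^sup>2) \<nu> (2 * p) \<le> 2" .
    qed (use s in auto)
    finally show ?case by (simp add: p_def power_mult s)
  qed
qed

text \<open>Any failure forces an even trace of \<open>S\<close>, the squared total sum, or the
  squared deviation of the row square sum to be large; Markov's inequality handles each.\<close>

lemma few_bad_graphs:
  fixes \<delta> :: real
  assumes \<delta>: "0 < \<delta>"
  obtains b :: "nat \<Rightarrow> real" where "b \<longlonglongrightarrow> 0"
    "\<forall>\<^sub>F n in sequentially. real (card {E \<in> graphs_on n.
        \<not> (total_sum n E \<le> \<delta> * real n * sqrt (real n) \<and> row_square_sum n E \<le> (1 + \<delta>) * (real n)\<^sup>2 \<and>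
          (\<forall>x. (\<Sum>i<n. (\<Sum>j<n. sign_mat E i j * x j)\<^sup>2) \<le> 4 * (1 + \<delta>)\<^sup>2 * real n * (\<Sum>i<n. (x i)\<^sup>2)))})
      / real (card (graphs_on n)) \<le> b n"
proof -
  \<comment> \<open>A value strictly between 2 and \<open>2 * (1 + \<delta>)\<close>: the trace
    bound holds above 2, and staying below the norm threshold makes \<open>\<rho> < 1\<close>, so
    that \<open>\<rho>^p\<close> beats the factor \<open>2 n\<close>.\<close>
  define r where "r = 2 + \<delta>"
  define \<rho> where "\<rho> = (r / (2 * (1 + \<delta>)))\<^sup>2"
  have r: "2 < r" using \<delta> by (simp add: r_def)
  have \<rho>: "0 < \<rho>" "\<rho> < 1"
    using \<delta> by (auto simp: \<rho>_def r_def power_less_one_iff intro!: power_strict_mono)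
  define b where "b n = 2 * real n * \<rho> ^ walk_length n + 2 / (\<delta>\<^sup>2 * real n) + 7 / (\<delta>\<^sup>2 * real n)" for n
  have "b \<longlonglongrightarrow> 0 + 0 + 0"
    unfolding b_def[abs_def]
  proof (intro tendsto_add)
    define c where "c = - ln \<rho>"
    have c: "0 < c" using \<rho> by (simp add: c_def)
    have "(\<lambda>n::nat. 2 * real n * exp (- c * (real n powr (1/4) - 1))) \<longlonglongrightarrow> 0"
      using c by real_asymp
    then show "(\<lambda>n. 2 * real n * \<rho> ^ walk_length n) \<longlonglongrightarrow> 0"
    proof (rule Lim_null_comparison[rotated])
      show "\<forall>\<^sub>F n in sequentially. norm (2 * real n * \<rho> ^ walk_length n)
        \<le> 2 * real n * exp (- c * (real n powr (1/4) - 1))"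
        using eventually_gt_at_top[of 0]
      proof eventually_elim
        case (elim n)
        have "\<rho> ^ walk_length n = exp (- c * real (walk_length n))"
          using \<rho> by (simp add: c_def exp_of_nat_mult mult.commute[of "ln \<rho>"])
        also have "\<dots> \<le> exp (- c * (real n powr (1/4) - 1))"
          using walk_length_bounds(3)[OF elim] c by simp
        finally show ?case using \<rho> by (simp add: mult_left_mono)
      qed
    qed
    show "(\<lambda>n. 2 / (\<delta>\<^sup>2 * real n)) \<longlonglongrightarrow> 0" "(\<lambda>n. 7 / (\<delta>\<^sup>2 * real n)) \<longlonglongrightarrow> 0"
      using \<delta> by real_asymp+
  qed
  then have lim: "b \<longlonglongrightarrow> 0" by simp
  have bound: "\<forall>\<^sub>F n in sequentially. real (card {E \<in> graphs_on n.
        \<not> (total_sum n E \<le> \<delta> * real n * sqrt (real n) \<and> row_square_sum n E \<le> (1 + \<delta>) * (real n)\<^sup>2 \<and>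
          (\<forall>x. (\<Sum>i<n. (\<Sum>j<n. sign_mat E i j * x j)\<^sup>2) \<le> 4 * (1 + \<delta>)\<^sup>2 * real n * (\<Sum>i<n. (x i)\<^sup>2)))})
      / real (card (graphs_on n)) \<le> b n"
    using expct_strace_le_eventually[OF r] eventually_gt_at_top[of 0]
  proof eventually_elim
    case (elim n)
    define p where "p = walk_length n"
    define B where "B = 4 * (1 + \<delta>)\<^sup>2 * real n"
    have B: "0 < B" using elim(2) \<delta> by (simp add: B_def)
    define b1 where "b1 = {E \<in> graphs_on n. B ^ p < strace n (2 * p) E}"
    define b2 where "b2 = {E \<in> graphs_on n. \<delta>\<^sup>2 * real n ^ 3 < (total_sum n E)\<^sup>2}"
    define b3 where "b3 = {E \<in> graphs_on n. \<delta>\<^sup>2 * real n ^ 4 < (row_square_sum n E - (real n)\<^sup>2)\<^sup>2}"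
    have fin: "finite (graphs_on n)" by (simp add: graphs_on_eq finite_all_edges)
    have "{E \<in> graphs_on n.
        \<not> (total_sum n E \<le> \<delta> * real n * sqrt (real n) \<and> row_square_sum n E \<le> (1 + \<delta>) * (real n)\<^sup>2 \<and>
          (\<forall>x. (\<Sum>i<n. (\<Sum>j<n. sign_mat E i j * x j)\<^sup>2) \<le> 4 * (1 + \<delta>)\<^sup>2 * real n * (\<Sum>i<n. (x i)\<^sup>2)))}
      \<subseteq> b1 \<union> b2 \<union> b3" (is "?bad \<subseteq> _")
    proof
      fix E assume "E \<in> ?bad"
      then have E: "E \<in> graphs_on n" and bad: "\<not> total_sum n E \<le> \<delta> * real n * sqrt (real n) \<or>
        \<not> row_square_sum n E \<le> (1 + \<delta>) * (real n)\<^sup>2 \<or>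
        \<not> (\<forall>x. (\<Sum>i<n. (\<Sum>j<n. sign_mat E i j * x j)\<^sup>2) \<le> B * (\<Sum>i<n. (x i)\<^sup>2))"
        by (auto simp: B_def)
      from bad consider "\<delta> * real n * sqrt (real n) < total_sum n E"
        | "(1 + \<delta>) * (real n)\<^sup>2 < row_square_sum n E"
        | "\<not> (\<forall>x. (\<Sum>i<n. (\<Sum>j<n. sign_mat E i j * x j)\<^sup>2) \<le> B * (\<Sum>i<n. (x i)\<^sup>2))"
        unfolding not_le by blast
      then show "E \<in> b1 \<union> b2 \<union> b3"
      proof cases
        case 1
        have "(\<delta> * real n * sqrt (real n))\<^sup>2 < (total_sum n E)\<^sup>2"
          using 1 \<delta> by (intro power_strict_mono) auto
        then show ?thesis
          using E by (simp add: b2_def power_mult_distrib power2_eq_square power3_eq_cube mult_ac)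
      next
        case 2
        then have "\<delta> * (real n)\<^sup>2 < row_square_sum n E - (real n)\<^sup>2" by (simp add: algebra_simps)
        then have "(\<delta> * (real n)\<^sup>2)\<^sup>2 < (row_square_sum n E - (real n)\<^sup>2)\<^sup>2"
          using \<delta> by (intro power_strict_mono) auto
        then show ?thesis using E by (simp add: b3_def power_mult_distrib)
      next
        case 3
        then have "B ^ p < strace n (2 * p) E"
          using sum_square_mat_le_of_mtrace[where M = "sign_mat E" and B = B and n = n and p = p, OF sign_mat_sym]
            walk_length_bounds(1)[OF elim(2)] B
          unfolding strace_def p_def by force
        then show ?thesis using E by (simp add: b1_def)
      qed
    qed
    then have "card ?bad \<le> card (b1 \<union> b2 \<union> b3)"
      using fin by (intro card_mono) (auto simp: b1_def b2_def b3_def)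
    also have "\<dots> \<le> card b1 + card b2 + card b3"
      by (meson add_le_mono1 card_Un_le order_trans)
    finally have "real (card ?bad) \<le> real (card b1) + real (card b2) + real (card b3)"
      by linarith
    then have "real (card ?bad) / real (card (graphs_on n))
      \<le> real (card b1) / real (card (graphs_on n)) + real (card b2) / real (card (graphs_on n))
        + real (card b3) / real (card (graphs_on n))"
      by (simp add: divide_right_mono flip: add_divide_distrib)
    also have "\<dots> \<le> 2 * real n * \<rho> ^ p + 2 / (\<delta>\<^sup>2 * real n) + 7 / (\<delta>\<^sup>2 * real n)"
    proof (intro add_mono)
      have "real (card b1) / real (card (graphs_on n)) \<le> expct n (strace n (2 * p)) / B ^ p"
        unfolding b1_def using B by (intro markov_graphs strace_double_nonneg) auto
      also have "\<dots> \<le> 2 * real n * (r\<^sup>2 * real n) ^ p / B ^ p"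
        using elim(1) B unfolding p_def by (intro divide_right_mono) auto
      also have "\<dots> = 2 * real n * (r\<^sup>2 * real n / B) ^ p" by (simp add: power_divide)
      also have "r\<^sup>2 * real n / B = \<rho>"
        using elim(2) unfolding B_def \<rho>_def power_divide power_mult_distrib by simp
      finally show "real (card b1) / real (card (graphs_on n)) \<le> 2 * real n * \<rho> ^ p" .
      have "real (card b2) / real (card (graphs_on n)) \<le> expct n (\<lambda>E. (total_sum n E)\<^sup>2) / (\<delta>\<^sup>2 * real n ^ 3)"
        unfolding b2_def using elim(2) \<delta> by (intro markov_graphs) auto
      also have "\<dots> \<le> 2 * (real n)\<^sup>2 / (\<delta>\<^sup>2 * real n ^ 3)"
        by (intro divide_right_mono expct_total_sum_square_le) auto
      also have "\<dots> = 2 / (\<delta>\<^sup>2 * real n)"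
        using elim(2) by (simp add: field_simps power2_eq_square power3_eq_cube)
      finally show "real (card b2) / real (card (graphs_on n)) \<le> 2 / (\<delta>\<^sup>2 * real n)" .
      have "real (card b3) / real (card (graphs_on n))
        \<le> expct n (\<lambda>E. (row_square_sum n E - (real n)\<^sup>2)\<^sup>2) / (\<delta>\<^sup>2 * real n ^ 4)"
        unfolding b3_def using elim(2) \<delta> by (intro markov_graphs) auto
      also have "\<dots> \<le> 7 * real n ^ 3 / (\<delta>\<^sup>2 * real n ^ 4)"
        by (intro divide_right_mono expct_row_square_sum_deviation_le elim(2)) auto
      also have "\<dots> = 7 / (\<delta>\<^sup>2 * real n)"
        using elim(2) by (simp add: field_simps power3_eq_cube power4_eq_xxxx)
      finally show "real (card b3) / real (card (graphs_on n)) \<le> 7 / (\<delta>\<^sup>2 * real n)" .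
    qed
    finally show ?case unfolding b_def p_def .
  qed
  show ?thesis by (rule that[OF lim bound])
qed

theorem theorem5:
  fixes \<alpha> A a :: real and \<epsilon> :: "nat \<Rightarrow> real" and k :: "nat \<Rightarrow> nat" and N :: "nat set"
  assumes "0 < \<alpha>" and "\<alpha> < 1" and "0 < A" and "0 \<le> a"
    and "N = {n. 1 \<le> n \<and> \<alpha> * real n \<in> \<int>}"
    and "\<And>n. n \<in> N \<Longrightarrow> \<epsilon> n = A / sqrt (real n)"
    and "\<And>n. n \<in> N \<Longrightarrow> real (k n) = \<alpha> * real n"
    and "\<alpha> * A + \<alpha> * a > sqrt (a\<^sup>2 + 5 / 4)"
  shows "certifies_most (skewed_spectral a) N k \<epsilon>"
proof -
  define \<theta> where "\<theta> = \<alpha> * A + \<alpha> * a"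
  define \<kappa> where "\<kappa> = \<theta>\<^sup>2 - (a\<^sup>2 + 5 / 4)"
  have "0 \<le> sqrt (a\<^sup>2 + 5 / 4)" by simp
  then have \<theta>: "0 < \<theta>" using assms(8) unfolding \<theta>_def by linarith
  have "sqrt (a\<^sup>2 + 5 / 4) ^ 2 < \<theta>\<^sup>2"
    using assms(8) unfolding \<theta>_def by (intro power_strict_mono) auto
  then have \<kappa>: "0 < \<kappa>" by (simp add: \<kappa>_def)
  \<comment> \<open>The radicand of \<open>\<tau>\<close> exceeds \<open>a^2 + 5/4\<close> by
    \<open>\<delta> (a + 9/4 + \<delta>)\<close>, at most \<open>\<delta> (a + 4)\<close> for
    \<open>\<delta>\<close> up to 1. This choice spends at most half of the slack
    \<open>\<kappa>\<close>.\<close>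
  define \<delta> where "\<delta> = min 1 (\<kappa> / (2 * (a + 4)))"
  have \<delta>: "0 < \<delta>" "\<delta> \<le> 1" "\<delta> \<le> \<kappa> / (2 * (a + 4))" using \<kappa> assms(4) by (auto simp: \<delta>_def)
  define R where "R = (1 + \<delta>)\<^sup>2"
  have R: "0 < R" using \<delta> by (simp add: R_def)
  define \<tau> where "\<tau> = sqrt ((1 + \<delta>) / 4 + a * \<delta> + a\<^sup>2 + R)"
  have "(1 + \<delta>) / 4 + a * \<delta> + a\<^sup>2 + R = a\<^sup>2 + 5/4 + \<delta> * (a + 9/4 + \<delta>)"
    by (simp add: R_def power2_eq_square field_simps)
  also have "\<dots> \<le> a\<^sup>2 + 5/4 + \<delta> * (a + 4)"
    using \<delta> by (intro add_left_mono mult_left_mono) auto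
  also have "\<dots> \<le> a\<^sup>2 + 5/4 + \<kappa> / 2"
    using \<delta>(3) assms(4) by (simp add: field_simps)
  also have "\<dots> < \<theta>\<^sup>2" using \<kappa> by (simp add: \<kappa>_def field_simps)
  finally have \<tau>: "\<tau> < \<theta>" unfolding \<tau>_def using \<theta> by (simp add: real_less_lsqrt)
  have N: "0 < n" "0 < k n" if "n \<in> N" for n
  proof -
    show "0 < n" using that assms(5) by auto
    then have "0 < real (k n)" using assms(1) assms(7)[OF that] by simp
    then show "0 < k n" by simp
  qed
  have sound: "\<forall>n\<in>N. \<forall>E\<in>certified_graphs (skewed_spectral a) n (k n) (\<epsilon> n).
      \<not> has_subgraph_with_excess n E (k n) (\<epsilon> n)"
    using skewed_spectral_sound N by blast
  obtain b :: "nat \<Rightarrow> real" where b: "b \<longlonglongrightarrow> 0" and few: "\<forall>\<^sub>F n in sequentially. real (card {E \<in> graphs_on n.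
        \<not> (total_sum n E \<le> \<delta> * real n * sqrt (real n) \<and> row_square_sum n E \<le> (1 + \<delta>) * (real n)\<^sup>2 \<and>
          (\<forall>x. (\<Sum>i<n. (\<Sum>j<n. sign_mat E i j * x j)\<^sup>2) \<le> 4 * R * real n * (\<Sum>i<n. (x i)\<^sup>2)))})
      / real (card (graphs_on n)) \<le> b n"
    unfolding R_def by (rule few_bad_graphs[OF \<delta>(1)])
  let ?F = "inf sequentially (principal N)"
  let ?frac = "\<lambda>n. real (card (certified_graphs (skewed_spectral a) n (k n) (\<epsilon> n))) / real (card (graphs_on n))"
  \<comment> \<open>The certificate has \<open>k - 1\<close> in place of \<open>k\<close>, a loss of
    \<open>A / sqrt n\<close>. The gap \<open>(\<theta> - \<tau>) sqrt n\<close> exceeds it from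
    this threshold on.\<close>
  have "\<forall>\<^sub>F n in sequentially. A / (\<theta> - \<tau>) < real n"
    by (rule filterlim_at_top_dense[THEN iffD1, rule_format, OF filterlim_real_sequentially])
  with few have "\<forall>\<^sub>F n in sequentially. n \<in> N \<longrightarrow> 1 - b n \<le> ?frac n"
  proof eventually_elim
    case (elim n)
    show ?case
    proof
      assume n: "n \<in> N"
      define good where "good E \<longleftrightarrow> total_sum n E \<le> \<delta> * real n * sqrt (real n) \<and>
        row_square_sum n E \<le> (1 + \<delta>) * (real n)\<^sup>2 \<and>
        (\<forall>x. (\<Sum>i<n. (\<Sum>j<n. sign_mat E i j * x j)\<^sup>2) \<le> 4 * R * real n * (\<Sum>i<n. (x i)\<^sup>2))" for E
      let ?C = "certified_graphs (skewed_spectral a) n (k n) (\<epsilon> n)"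
      have fin: "finite (graphs_on n)" by (simp add: graphs_on_eq finite_all_edges)
      have pos: "0 < real (card (graphs_on n))" by (simp add: graphs_on_eq finite_all_edges card_Pow)
      have "E \<in> ?C" if E: "E \<in> graphs_on n" "good E" for E
      proof -
        have "largest_eigenvalue (skewed_adjacency a n E) \<le> sqrt (real n) * \<tau>"
          unfolding \<tau>_def
          by (rule largest_eigenvalue_skewed_le[OF N(1)[OF n] assms(4) \<delta>(1) _ _ _ R])
             (use E(2) in \<open>auto simp: good_def\<close>)
        also have "\<dots> < sqrt (real n) * \<theta> - A / sqrt (real n)"
        proof -
          have "A < (\<theta> - \<tau>) * real n" using elim(2) \<tau> by (simp add: field_simps)
          then have "A / sqrt (real n) < (\<theta> - \<tau>) * real n / sqrt (real n)"
            using N(1)[OF n] by (intro divide_strict_right_mono) auto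
          also have "\<dots> = (\<theta> - \<tau>) * sqrt (real n)" by (simp add: real_div_sqrt flip: times_divide_eq_right)
          finally show ?thesis by (simp add: algebra_simps)
        qed
        also have "\<dots> = \<epsilon> n * (real (k n) - 1) + real (k n) * a / sqrt (real n)"
        proof -
          have "real (k n) / sqrt (real n) = \<alpha> * sqrt (real n)"
            using assms(7)[OF n] by (simp add: real_div_sqrt flip: times_divide_eq_right)
          moreover have "\<epsilon> n * (real (k n) - 1) + real (k n) * a / sqrt (real n) =
            (A + a) * (real (k n) / sqrt (real n)) - A / sqrt (real n)"
            unfolding assms(6)[OF n] by (simp add: algebra_simps diff_divide_distrib add_divide_distrib)
          ultimately show ?thesis by (simp add: \<theta>_def algebra_simps)
        qed
        finally show ?thesis using E(1) by (simp add: certified_graphs_def skewed_spectral_def)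
      qed
      then have "graphs_on n \<subseteq> ?C \<union> {E \<in> graphs_on n. \<not> good E}" by auto
      then have "card (graphs_on n) \<le> card (?C \<union> {E \<in> graphs_on n. \<not> good E})"
        using fin by (intro card_mono) (auto simp: certified_graphs_def)
      also have "\<dots> \<le> card ?C + card {E \<in> graphs_on n. \<not> good E}" by (rule card_Un_le)
      finally have "real (card (graphs_on n)) \<le> real (card ?C) + real (card {E \<in> graphs_on n. \<not> good E})"
        by linarith
      then have "1 \<le> ?frac n + real (card {E \<in> graphs_on n. \<not> good E}) / real (card (graphs_on n))"
        using pos by (simp add: le_divide_eq_1_pos flip: add_divide_distrib)
      with elim(1) show "1 - b n \<le> ?frac n" unfolding good_def by linarith
    qed
  qed
  then have lower: "\<forall>\<^sub>F n in ?F. 1 - b n \<le> ?frac n"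
    by (simp add: eventually_inf_principal)
  have upper: "\<forall>\<^sub>F n in ?F. ?frac n \<le> 1"
  proof (rule always_eventually, rule allI)
    fix n
    have "card (certified_graphs (skewed_spectral a) n (k n) (\<epsilon> n)) \<le> card (graphs_on n)"
      by (intro card_mono) (auto simp: certified_graphs_def graphs_on_eq finite_all_edges)
    then show "?frac n \<le> 1" by (auto simp: divide_le_eq_1)
  qed
  have "((\<lambda>n. 1 - b n) \<longlongrightarrow> 1 - 0) ?F"
    by (intro tendsto_intros tendsto_mono[OF _ b]) simp
  then have "(?frac \<longlongrightarrow> 1) ?F"
    by (intro tendsto_sandwich[OF lower upper]) auto
  with sound show ?thesis unfolding certifies_most_def by blast
qed

end
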